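(* Let $(\Gamma,L)$ be a periodic graph and let $x_0\in V_\Gamma$ be $P$-initial. For each vertex $v\in V(P_\Gamma)\setminus\{0\}$ pick a cycle $q_v$ of $\Gamma/L$ with $\mu(q_v)/w(q_v)=v$ and $\overline{x_0}\in\mathrm{supp}(q_v)$. Then $\mathrm{LCM}\{w(q_v): v\in V(P_\Gamma)\setminus\{0\}\}$ is a quasi-period of the growth sequence $(s_{\Gamma,x_0,d})_d$. More precisely, the growth series has the form $$G_{\Gamma,x_0}(t)=\frac{Q(t)}{\prod_{v\in V(P_\Gamma)\setminus\{0\}}(1-t^{w(q_v)})}$$ for some polynomial $Q(t)$. In particular, if $\Gamma$ is unweighted, then $\mathrm{LCM}\{1,2,\dots,\#(V_\Gamma/L)\}$ is a quasi-period of the growth sequence.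
   Context: A graph $\Gamma=(V_\Gamma,E_\Gamma,s,t,w)$ is a directed graph (loops and multiple edges allowed) with source/target maps $s,t$ and weight $w:E_\Gamma\to\mathbb Z_{>0}$; it is unweighted if $w\equiv1$. A walk is a sequence $p=e_1\cdots e_\ell$ of edges with $t(e_i)=s(e_{i+1})$; $w(p)=\sum w(e_i)$, $\mathrm{supp}(p)=\{s(e_1),t(e_1),\dots,t(e_\ell)\}$. A cycle is a walk with $\ell\ge1$, $s(e_1)=t(e_\ell)$ and $t(e_1),\dots,t(e_\ell)$ distinct. $d_\Gamma(x,y)$ is the minimum weight of a walk from $x$ to $y$ ($\infty$ if none). An $n$-dimensional periodic graph $(\Gamma,L)$: $L\cong\mathbb Z^n$ acts freely on $V_\Gamma$ and $E_\Gamma$ with finitely many orbits on each, compatibly with $s,t,w$. The quotient graph $\Gamma/L$ has vertices $V_\Gamma/L$, edges $E_\Gamma/L$; bars denote images. For a cycle $q$ of $\Gamma/L$, $\mu(q):=t(\tilde q)-s(\tilde q)\in L$ for any lift $\tilde q$ of $q$ to a walk in $\Gamma$ (where for $x,y$ in one orbit, $y-x\in L$ is the unique element sending $x$ to $y$). The growth polytope is $P_\Gamma:=\mathrm{conv}(\{\mu(q)/w(q): q \text{ a cycle of }\Gamma/L\}\cup\{0\})\subset L\otimes\mathbb R$, and $V(P_\Gamma)$ is its vertex set. A vertex $y$ is $P$-initial if for every $u\in V(P_\Gamma)\setminus\{0\}$ there is a cycle $p_u$ of $\Gamma/L$ with $\mu(p_u)/w(p_u)=u$ and $\overline y\in\mathrm{supp}(p_u)$.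 $s_{\Gamma,x_0,d}:=\#\{y: d_\Gamma(x_0,y)=d\}$ and $G_{\Gamma,x_0}(t):=\sum_{d\ge0}s_{\Gamma,x_0,d}t^d$. A function $g:\mathbb Z_{\ge0}\to\mathbb C$ has quasi-period $N\in\mathbb Z_{>0}$ if there are polynomials $Q_0,\dots,Q_{N-1}$ such that $g(m)=Q_j(m)$ for all sufficiently large $m$ with $m\equiv j\pmod N$. *)

theory Defs
  imports
    "HOL-Analysis.Analysis"
    "HOL-Computational_Algebra.Computational_Algebra"
    "Graph_Theory.Arc_Walk"
begin

text \<open>
  A group \<open>L \<cong> \<int>\<^sup>n\<close> is realised as the integer span of \<open>n\<close> linearly independent
  vectors of a Euclidean space, so that \<open>L \<otimes> \<real>\<close> is the real span of \<open>L\<close> there.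
  (Unlike an index type, this also covers \<open>n = 0\<close>.)
\<close>

definition lattice_of_rank :: "nat \<Rightarrow> 'l::euclidean_space set \<Rightarrow> bool" where
  "lattice_of_rank n L \<longleftrightarrow>
     (\<exists>B. independent B \<and> card B = n \<and>
          L = {\<Sum>b\<in>B. real_of_int (c b) *\<^sub>R b | c. True})"

record ('v, 'e, 'l) periodic_graph_data =
  digraph_of :: "('v, 'e) pre_digraph"
  weight :: "'e \<Rightarrow> nat"
  lattice :: "'l set"
  vact :: "'l \<Rightarrow> 'v \<Rightarrow> 'v"
  eact :: "'l \<Rightarrow> 'e \<Rightarrow> 'e"

definition vorbit :: "('v, 'e, 'l) periodic_graph_data \<Rightarrow> 'v \<Rightarrow> 'v set" where
  "vorbit \<Gamma> x = (\<lambda>a. vact \<Gamma> a x) ` lattice \<Gamma>"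

definition eorbit :: "('v, 'e, 'l) periodic_graph_data \<Rightarrow> 'e \<Rightarrow> 'e set" where
  "eorbit \<Gamma> e = (\<lambda>a. eact \<Gamma> a e) ` lattice \<Gamma>"

locale periodic_graph =
  fixes n :: nat and \<Gamma> :: "('v, 'e, 'l::euclidean_space) periodic_graph_data"
  assumes wf: "wf_digraph (digraph_of \<Gamma>)"
    and weight_pos: "e \<in> arcs (digraph_of \<Gamma>) \<Longrightarrow> weight \<Gamma> e > 0"
    and lattice: "lattice_of_rank n (lattice \<Gamma>)"
    and vact_closed: "\<lbrakk>a \<in> lattice \<Gamma>; x \<in> verts (digraph_of \<Gamma>)\<rbrakk> \<Longrightarrow> vact \<Gamma> a x \<in> verts (digraph_of \<Gamma>)"
    and vact_zero: "x \<in> verts (digraph_of \<Gamma>) \<Longrightarrow> vact \<Gamma> 0 x = x"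
    and vact_add: "\<lbrakk>a \<in> lattice \<Gamma>; b \<in> lattice \<Gamma>; x \<in> verts (digraph_of \<Gamma>)\<rbrakk>
        \<Longrightarrow> vact \<Gamma> (a + b) x = vact \<Gamma> a (vact \<Gamma> b x)"
    and vact_free: "\<lbrakk>a \<in> lattice \<Gamma>; x \<in> verts (digraph_of \<Gamma>); vact \<Gamma> a x = x\<rbrakk> \<Longrightarrow> a = 0"
    and eact_closed: "\<lbrakk>a \<in> lattice \<Gamma>; e \<in> arcs (digraph_of \<Gamma>)\<rbrakk> \<Longrightarrow> eact \<Gamma> a e \<in> arcs (digraph_of \<Gamma>)"
    and eact_zero: "e \<in> arcs (digraph_of \<Gamma>) \<Longrightarrow> eact \<Gamma> 0 e = e"
    and eact_add: "\<lbrakk>a \<in> lattice \<Gamma>; b \<in> lattice \<Gamma>; e \<in> arcs (digraph_of \<Gamma>)\<rbrakk>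
        \<Longrightarrow> eact \<Gamma> (a + b) e = eact \<Gamma> a (eact \<Gamma> b e)"
    and eact_free: "\<lbrakk>a \<in> lattice \<Gamma>; e \<in> arcs (digraph_of \<Gamma>); eact \<Gamma> a e = e\<rbrakk> \<Longrightarrow> a = 0"
    and finite_vorbits: "finite (vorbit \<Gamma> ` verts (digraph_of \<Gamma>))"
    and finite_eorbits: "finite (eorbit \<Gamma> ` arcs (digraph_of \<Gamma>))"
    and tail_eact: "\<lbrakk>a \<in> lattice \<Gamma>; e \<in> arcs (digraph_of \<Gamma>)\<rbrakk>
        \<Longrightarrow> tail (digraph_of \<Gamma>) (eact \<Gamma> a e) = vact \<Gamma> a (tail (digraph_of \<Gamma>) e)"
    and head_eact: "\<lbrakk>a \<in> lattice \<Gamma>; e \<in> arcs (digraph_of \<Gamma>)\<rbrakk>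
        \<Longrightarrow> head (digraph_of \<Gamma>) (eact \<Gamma> a e) = vact \<Gamma> a (head (digraph_of \<Gamma>) e)"
    and weight_eact: "\<lbrakk>a \<in> lattice \<Gamma>; e \<in> arcs (digraph_of \<Gamma>)\<rbrakk>
        \<Longrightarrow> weight \<Gamma> (eact \<Gamma> a e) = weight \<Gamma> e"

text \<open>
  By equivariance, the image of an edge orbit under the source (target) map is exactly
  the orbit of the source (target), and the weight is constant on it.
\<close>

definition quotient_graph :: "('v, 'e, 'l) periodic_graph_data \<Rightarrow> ('v set, 'e set) pre_digraph" where
  "quotient_graph \<Gamma> =
     \<lparr>verts = vorbit \<Gamma> ` verts (digraph_of \<Gamma>),
      arcs = eorbit \<Gamma> ` arcs (digraph_of \<Gamma>),
      tail = (\<lambda>C. tail (digraph_of \<Gamma>) ` C),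
      head = (\<lambda>C. head (digraph_of \<Gamma>) ` C)\<rparr>"

definition quotient_weight :: "('v, 'e, 'l) periodic_graph_data \<Rightarrow> 'e set \<Rightarrow> nat" where
  "quotient_weight \<Gamma> C = the_elem (weight \<Gamma> ` C)"

definition walk_weight :: "('e \<Rightarrow> nat) \<Rightarrow> 'e list \<Rightarrow> nat" where
  "walk_weight w p = sum_list (map w p)"

text \<open>The support of a walk, for walks with at least one edge.\<close>

definition walk_supp :: "('v, 'e) pre_digraph \<Rightarrow> 'e list \<Rightarrow> 'v set" where
  "walk_supp G p = insert (tail G (hd p)) (head G ` set p)"

definition is_quotient_cycle :: "('v, 'e, 'l) periodic_graph_data \<Rightarrow> 'e set list \<Rightarrow> bool" where
  "is_quotient_cycle \<Gamma> q \<longleftrightarrow> pre_digraph.cycle (quotient_graph \<Gamma>) q"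

abbreviation cycle_weight :: "('v, 'e, 'l) periodic_graph_data \<Rightarrow> 'e set list \<Rightarrow> nat" where
  "cycle_weight \<Gamma> \<equiv> walk_weight (quotient_weight \<Gamma>)"

text \<open>
  The displacement \<open>\<mu>(q)\<close>: the unique \<open>a \<in> L\<close> such that some (equivalently, by
  \<open>cycle_displacement_eq\<close> below, every) lift of \<open>q\<close> leads from a vertex \<open>x\<close> to \<open>a + x\<close>.
\<close>

definition cycle_displacement ::
    "('v, 'e, 'l) periodic_graph_data \<Rightarrow> 'e set list \<Rightarrow> 'l" where
  "cycle_displacement \<Gamma> q =
     (THE a. a \<in> lattice \<Gamma> \<and>
        (\<exists>x p. pre_digraph.awalk (digraph_of \<Gamma>) x p (vact \<Gamma> a x) \<and> map (eorbit \<Gamma>) p = q))"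

definition cycle_direction ::
    "('v, 'e, 'l::euclidean_space) periodic_graph_data \<Rightarrow> 'e set list \<Rightarrow> 'l" where
  "cycle_direction \<Gamma> q = cycle_displacement \<Gamma> q /\<^sub>R real (cycle_weight \<Gamma> q)"

definition growth_polytope ::
    "('v, 'e, 'l::euclidean_space) periodic_graph_data \<Rightarrow> 'l set" where
  "growth_polytope \<Gamma> =
     convex hull ({cycle_direction \<Gamma> q | q. is_quotient_cycle \<Gamma> q} \<union> {0})"

definition polytope_vertices :: "'l::euclidean_space set \<Rightarrow> 'l set" where
  "polytope_vertices P = {v. v extreme_point_of P}"

definition P_initial ::
    "('v, 'e, 'l::euclidean_space) periodic_graph_data \<Rightarrow> 'v \<Rightarrow> bool" where
  "P_initial \<Gamma> y \<longleftrightarrow>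
     y \<in> verts (digraph_of \<Gamma>) \<and>
     (\<forall>u \<in> polytope_vertices (growth_polytope \<Gamma>) - {0}.
        \<exists>p. is_quotient_cycle \<Gamma> p \<and> cycle_direction \<Gamma> p = u \<and>
            vorbit \<Gamma> y \<in> walk_supp (quotient_graph \<Gamma>) p)"

text \<open>
  On \<^typ>\<open>enat\<close> the infimum of a nonempty set is its minimum, and that of the empty set is \<open>\<infinity>\<close>.
\<close>

definition graph_dist :: "('v, 'e, 'l) periodic_graph_data \<Rightarrow> 'v \<Rightarrow> 'v \<Rightarrow> enat" where
  "graph_dist \<Gamma> x y =
     (INF p \<in> {p. pre_digraph.awalk (digraph_of \<Gamma>) x p y}. enat (walk_weight (weight \<Gamma>) p))"

definition growth_seq :: "('v, 'e, 'l) periodic_graph_data \<Rightarrow> 'v \<Rightarrow> nat \<Rightarrow> nat" where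
  "growth_seq \<Gamma> x d = card {y \<in> verts (digraph_of \<Gamma>). graph_dist \<Gamma> x y = enat d}"

definition growth_series :: "('v, 'e, 'l) periodic_graph_data \<Rightarrow> 'v \<Rightarrow> complex fps" where
  "growth_series \<Gamma> x = Abs_fps (\<lambda>d. of_nat (growth_seq \<Gamma> x d))"

definition has_quasi_period :: "(nat \<Rightarrow> complex) \<Rightarrow> nat \<Rightarrow> bool" where
  "has_quasi_period g N \<longleftrightarrow>
     N > 0 \<and>
     (\<exists>Q :: nat \<Rightarrow> complex poly. \<forall>j<N.
        \<forall>\<^sub>F m in sequentially. m mod N = j \<longrightarrow> g m = poly (Q j) (of_nat m))"

definition unweighted :: "('v, 'e, 'l) periodic_graph_data \<Rightarrow> bool" where
  "unweighted \<Gamma> \<longleftrightarrow> (\<forall>e \<in> arcs (digraph_of \<Gamma>). weight \<Gamma> e = 1)"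

lemma lattice_of_rank_closed:
  assumes "lattice_of_rank n L"
  shows "0 \<in> L" and "a \<in> L \<Longrightarrow> b \<in> L \<Longrightarrow> a - b \<in> L" and "a \<in> L \<Longrightarrow> b \<in> L \<Longrightarrow> a + b \<in> L"
proof -
  obtain B where L: "L = {\<Sum>b\<in>B. real_of_int (c b) *\<^sub>R b | c. True}"
    using assms by (auto simp: lattice_of_rank_def)
  show "0 \<in> L"
    unfolding L by (rule CollectI, rule exI[of _ "\<lambda>_. 0"]) simp
  show "a - b \<in> L" if ab: "a \<in> L" "b \<in> L"
  proof -
    obtain c d where "a = (\<Sum>b\<in>B. real_of_int (c b) *\<^sub>R b)" "b = (\<Sum>b\<in>B. real_of_int (d b) *\<^sub>R b)"
      using ab L by auto
    then have "a - b = (\<Sum>b\<in>B. real_of_int (c b - d b) *\<^sub>R b)"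
      by (simp add: sum_subtractf scaleR_diff_left)
    then show ?thesis unfolding L by (intro CollectI exI[of _ "\<lambda>b. c b - d b"]) simp
  qed
  show "a + b \<in> L" if ab: "a \<in> L" "b \<in> L"
  proof -
    obtain c d where "a = (\<Sum>b\<in>B. real_of_int (c b) *\<^sub>R b)" "b = (\<Sum>b\<in>B. real_of_int (d b) *\<^sub>R b)"
      using ab L by auto
    then have "a + b = (\<Sum>b\<in>B. real_of_int (c b + d b) *\<^sub>R b)"
      by (simp add: sum.distrib scaleR_add_left)
    then show ?thesis unfolding L by (intro CollectI exI[of _ "\<lambda>b. c b + d b"]) simp
  qed
qed

context periodic_graph
begin

lemmas lattice_zero = lattice_of_rank_closed(1)[OF lattice]
  and lattice_diff = lattice_of_rank_closed(2)[OF lattice]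
  and lattice_add = lattice_of_rank_closed(3)[OF lattice]

lemma lattice_uminus: "a \<in> lattice \<Gamma> \<Longrightarrow> - a \<in> lattice \<Gamma>"
  using lattice_diff[OF lattice_zero] by simp

lemma vact_inj:
  assumes "a \<in> lattice \<Gamma>" "b \<in> lattice \<Gamma>" "x \<in> verts (digraph_of \<Gamma>)" "vact \<Gamma> a x = vact \<Gamma> b x"
  shows "a = b"
proof -
  have "vact \<Gamma> (- b + a) x = vact \<Gamma> (- b + b) x"
    using assms by (simp only: vact_add lattice_uminus)
  then have "- b + a = 0"
    using assms vact_zero by (intro vact_free[of _ x] lattice_add lattice_uminus) auto
  then show ?thesis by simp
qed

lemma vorbit_self: "x \<in> verts (digraph_of \<Gamma>) \<Longrightarrow> x \<in> vorbit \<Gamma> x"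
  unfolding vorbit_def using vact_zero lattice_zero by force

lemma eorbit_self: "e \<in> arcs (digraph_of \<Gamma>) \<Longrightarrow> e \<in> eorbit \<Gamma> e"
  unfolding eorbit_def using eact_zero lattice_zero by force

lemma tail_eorbit: "e \<in> arcs (digraph_of \<Gamma>) \<Longrightarrow> tail (digraph_of \<Gamma>) ` eorbit \<Gamma> e = vorbit \<Gamma> (tail (digraph_of \<Gamma>) e)"
  by (auto simp: eorbit_def vorbit_def tail_eact image_image)

lemma head_eorbit: "e \<in> arcs (digraph_of \<Gamma>) \<Longrightarrow> head (digraph_of \<Gamma>) ` eorbit \<Gamma> e = vorbit \<Gamma> (head (digraph_of \<Gamma>) e)"
  by (auto simp: eorbit_def vorbit_def head_eact image_image)

lemma quotient_weight_eorbit: "e \<in> arcs (digraph_of \<Gamma>) \<Longrightarrow> quotient_weight \<Gamma> (eorbit \<Gamma> e) = weight \<Gamma> e"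
proof -
  assume "e \<in> arcs (digraph_of \<Gamma>)"
  then have "weight \<Gamma> ` eorbit \<Gamma> e = {weight \<Gamma> e}"
    using lattice_zero by (auto simp: eorbit_def weight_eact image_image)
  then show ?thesis by (simp add: quotient_weight_def)
qed

lemma eorbit_eact: 
  assumes "a \<in> lattice \<Gamma>" "e \<in> arcs (digraph_of \<Gamma>)" 
  shows "eorbit \<Gamma> (eact \<Gamma> a e) = eorbit \<Gamma> e"
proof -
  have "eact \<Gamma> b e \<in> eorbit \<Gamma> (eact \<Gamma> a e)" if "b \<in> lattice \<Gamma>" for b
  proof -
    have "eact \<Gamma> (b - a) (eact \<Gamma> a e) = eact \<Gamma> b e"
      using that assms by (simp add: eact_add[symmetric] lattice_diff)
    then show ?thesis unfolding eorbit_def using that assms lattice_diff by (metis imageI)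
  qed
  moreover have "eact \<Gamma> b (eact \<Gamma> a e) \<in> eorbit \<Gamma> e" if "b \<in> lattice \<Gamma>" for b
    using that assms by (simp add: eorbit_def eact_add[symmetric] lattice_add)
  ultimately show ?thesis by (auto simp: eorbit_def)
qed

lemma wf_quotient_graph: "wf_digraph (quotient_graph \<Gamma>)"
proof -
  interpret wf_digraph "digraph_of \<Gamma>" by (rule wf)
  show ?thesis
    by unfold_locales (auto simp: quotient_graph_def tail_eorbit head_eorbit)
qed

lemma quotient_graph_sel:
  "verts (quotient_graph \<Gamma>) = vorbit \<Gamma> ` verts (digraph_of \<Gamma>)"
  "arcs (quotient_graph \<Gamma>) = eorbit \<Gamma> ` arcs (digraph_of \<Gamma>)"
  "tail (quotient_graph \<Gamma>) C = tail (digraph_of \<Gamma>) ` C"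
  "head (quotient_graph \<Gamma>) C = head (digraph_of \<Gamma>) ` C"
  by (simp_all add: quotient_graph_def)

lemma lift_walk:
  assumes "pre_digraph.awalk (quotient_graph \<Gamma>) X q Y" "x \<in> X"
  shows "\<exists>p y. pre_digraph.awalk (digraph_of \<Gamma>) x p y \<and> map (eorbit \<Gamma>) p = q \<and> y \<in> Y"
  using assms
proof (induction q arbitrary: X x)
  interpret G: wf_digraph "digraph_of \<Gamma>" by (rule wf)
  interpret Q: wf_digraph "quotient_graph \<Gamma>" by (rule wf_quotient_graph)
  case Nil
  then have "X = Y" "x \<in> verts (digraph_of \<Gamma>)"
    by (auto simp: Q.awalk_Nil_iff quotient_graph_sel vorbit_def vact_closed)
  then show ?case using Nil by (intro exI[of _ "[]"] exI[of _ x]) (simp add: G.awalk_Nil_iff)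
next
  interpret G: wf_digraph "digraph_of \<Gamma>" by (rule wf)
  interpret Q: wf_digraph "quotient_graph \<Gamma>" by (rule wf_quotient_graph)
  case (Cons C q)
  then obtain e where e: "e \<in> arcs (digraph_of \<Gamma>)" "C = eorbit \<Gamma> e" "X = vorbit \<Gamma> (tail (digraph_of \<Gamma>) e)"
      and w: "Q.awalk (vorbit \<Gamma> (head (digraph_of \<Gamma>) e)) q Y"
    by (auto simp: Q.awalk_Cons_iff quotient_graph_sel tail_eorbit head_eorbit)
  then obtain a where a: "a \<in> lattice \<Gamma>" "x = vact \<Gamma> a (tail (digraph_of \<Gamma>) e)"
    using Cons.prems by (auto simp: vorbit_def)
  have "head (digraph_of \<Gamma>) (eact \<Gamma> a e) \<in> vorbit \<Gamma> (head (digraph_of \<Gamma>) e)"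
    using a e by (simp add: head_eact vorbit_def)
  from Cons.IH[OF w this] obtain p y where
    "G.awalk (head (digraph_of \<Gamma>) (eact \<Gamma> a e)) p y" "map (eorbit \<Gamma>) p = q" "y \<in> Y" by blast
  then show ?case using a e
    by (intro exI[of _ "eact \<Gamma> a e # p"] exI[of _ y])
      (simp add: G.awalk_Cons_iff eact_closed tail_eact eorbit_eact)
qed

lemma lift_translate:
  assumes "pre_digraph.awalk (digraph_of \<Gamma>) x p y" "pre_digraph.awalk (digraph_of \<Gamma>) (vact \<Gamma> a x) p' y'"
    and "map (eorbit \<Gamma>) p = map (eorbit \<Gamma>) p'" "a \<in> lattice \<Gamma>"
  shows "y' = vact \<Gamma> a y"
  using assms
proof (induction p arbitrary: x p')
  interpret G: wf_digraph "digraph_of \<Gamma>" by (rule wf)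
  case Nil
  then show ?case by (simp add: G.awalk_Nil_iff)
next
  interpret G: wf_digraph "digraph_of \<Gamma>" by (rule wf)
  case (Cons e p)
  then obtain e' r where p': "p' = e' # r" and o: "eorbit \<Gamma> e = eorbit \<Gamma> e'"
    "map (eorbit \<Gamma>) p = map (eorbit \<Gamma>) r" by (cases p') auto
  have e: "e \<in> arcs (digraph_of \<Gamma>)" "x = tail (digraph_of \<Gamma>) e" "G.awalk (head (digraph_of \<Gamma>) e) p y"
    and e': "e' \<in> arcs (digraph_of \<Gamma>)" "vact \<Gamma> a x = tail (digraph_of \<Gamma>) e'" "G.awalk (head (digraph_of \<Gamma>) e') r y'"
    using Cons.prems by (auto simp: p' G.awalk_Cons_iff)
  from eorbit_self[OF e'(1)] o obtain b where b: "b \<in> lattice \<Gamma>" "e' = eact \<Gamma> b e"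
    by (auto simp: eorbit_def)
  have "b = a" using vact_inj[of b a x] b e e' Cons.prems by (simp add: tail_eact)
  then have "head (digraph_of \<Gamma>) e' = vact \<Gamma> a (head (digraph_of \<Gamma>) e)"
    using b e by (simp add: head_eact)
  then show ?case using Cons.IH[OF e(3) _ o(2) Cons.prems(4)] e'(3) by simp
qed

lemma lift_displacement_unique:
  assumes "pre_digraph.awalk (digraph_of \<Gamma>) x p (vact \<Gamma> a x)" "a \<in> lattice \<Gamma>"
    and "pre_digraph.awalk (digraph_of \<Gamma>) x' p' (vact \<Gamma> b x')" "b \<in> lattice \<Gamma>"
    and "map (eorbit \<Gamma>) p = map (eorbit \<Gamma>) p'" "p \<noteq> []"
  shows "a = b"
proof -
  interpret G: wf_digraph "digraph_of \<Gamma>" by (rule wf)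
  obtain e r e' r' where p: "p = e # r" "p' = e' # r'" using assms by (cases p; cases p') auto
  then have e: "e \<in> arcs (digraph_of \<Gamma>)" "x = tail (digraph_of \<Gamma>) e" "e' \<in> arcs (digraph_of \<Gamma>)" "x' = tail (digraph_of \<Gamma>) e'"
    using assms by (auto simp: G.awalk_Cons_iff)
  from eorbit_self[OF e(3)] assms(5) p obtain c where c: "c \<in> lattice \<Gamma>" "e' = eact \<Gamma> c e"
    by (auto simp: eorbit_def)
  then have x': "x' = vact \<Gamma> c x" and x: "x \<in> verts (digraph_of \<Gamma>)" using e by (auto simp: tail_eact)
  have "vact \<Gamma> b x' = vact \<Gamma> c (vact \<Gamma> a x)"
    using lift_translate[OF assms(1) _ assms(5) c(1)] assms(3) x' by simp
  then have "vact \<Gamma> (b + c) x = vact \<Gamma> (c + a) x"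
    using x x' assms c by (simp add: vact_add)
  then have "b + c = c + a" using x c assms by (intro vact_inj[of _ _ x] lattice_add) auto
  then show ?thesis by simp
qed

lemma cycle_displacement_eq:
  assumes "is_quotient_cycle \<Gamma> q" "pre_digraph.awalk (digraph_of \<Gamma>) x p (vact \<Gamma> a x)" "a \<in> lattice \<Gamma>"
    and "map (eorbit \<Gamma>) p = q"
  shows "cycle_displacement \<Gamma> q = a"
proof -
  have "p \<noteq> []" using assms(1,4) by (auto simp: is_quotient_cycle_def pre_digraph.cycle_def)
  then show ?thesis
    unfolding cycle_displacement_def using assms
    by (intro the_equality) (blast, metis lift_displacement_unique)
qed

lemma quotient_cycle_lift:
  assumes "is_quotient_cycle \<Gamma> q"
  obtains x p where "pre_digraph.awalk (digraph_of \<Gamma>) x p (vact \<Gamma> (cycle_displacement \<Gamma> q) x)"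
    "map (eorbit \<Gamma>) p = q" "cycle_displacement \<Gamma> q \<in> lattice \<Gamma>"
proof -
  interpret Q: wf_digraph "quotient_graph \<Gamma>" by (rule wf_quotient_graph)
  from assms obtain X where X: "Q.awalk X q X" by (auto simp: is_quotient_cycle_def Q.cycle_def)
  then obtain x where x: "x \<in> verts (digraph_of \<Gamma>)" "X = vorbit \<Gamma> x"
    using Q.awalk_hd_in_verts[OF X] by (auto simp: quotient_graph_sel)
  from lift_walk[OF X] vorbit_self x obtain p y where
    "pre_digraph.awalk (digraph_of \<Gamma>) x p y" "map (eorbit \<Gamma>) p = q" "y \<in> X" by blast
  moreover from this x obtain a where "a \<in> lattice \<Gamma>" "y = vact \<Gamma> a x" by (auto simp: vorbit_def)
  ultimately show ?thesis using cycle_displacement_eq[OF assms, of x p a] that by simp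
qed

end

end

theory Submission
  imports Defs
begin

text \<open>
  Let \<open>B\<close> be the set of pairs \<open>(y, d)\<close> with \<open>d(x\<^sub>0, y) \<le> d\<close>. Since each \<open>q\<^sub>v\<close> passes through the image
  of \<open>x\<^sub>0\<close>, it can be inserted into the projection of any walk from \<open>x\<^sub>0\<close>. So \<open>B\<close> is stable under the
  monoid \<open>M\<close> generated by \<open>(0, 1)\<close> and all \<open>(\<mu>(q\<^sub>v), w(q\<^sub>v))\<close>. Moreover \<open>B\<close> is finitely generated over \<open>M\<close>:
  a walk in the quotient splits into a walk of bounded length and cycles meeting it, and a
  positive multiple of every \<open>(\<mu>(c), w(c))\<close> lies in \<open>M\<close>, because \<open>\<mu>(c) / w(c)\<close> lies in the convex hull of \<open>0\<close>
  and the vertices \<open>v\<close>; so only bounded multiplicities of the cycles are needed in generators.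
  As for a finitely generated graded module, Hilbert's basis theorem makes the generating function of
  \<open>B\<close> by \<open>d\<close> a polynomial over \<open>(1 - t) \<Prod>\<^sub>v (1 - t\<^bsup>w(q\<^sub>v)\<^esup>)\<close>, and the growth series is \<open>1 - t\<close> times it.
\<close>

section \<open>Finitely generated sets over a commutative monoid\<close>

inductive_set nat_span :: "'a::comm_monoid_add set \<Rightarrow> 'a set" for G where
  zero_in_nat_span: "0 \<in> nat_span G"
| generator_plus_in_nat_span: "g \<in> G \<Longrightarrow> a \<in> nat_span G \<Longrightarrow> g + a \<in> nat_span G"

lemma nat_span_base: "g \<in> G \<Longrightarrow> g \<in> nat_span G"
  using generator_plus_in_nat_span[OF _ zero_in_nat_span] by force

lemma nat_span_add:
  assumes "a \<in> nat_span G" "b \<in> nat_span G"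
  shows "a + b \<in> nat_span G"
  using assms by (induction rule: nat_span.induct) (auto simp: add.assoc intro: nat_span.intros)

lemma nat_span_sum: "(\<And>i. i \<in> I \<Longrightarrow> f i \<in> nat_span G) \<Longrightarrow> sum f I \<in> nat_span G"
  by (induction I rule: infinite_finite_induct) (auto intro: zero_in_nat_span nat_span_add)

lemma nat_span_mono:
  assumes "G \<subseteq> H"
  shows "nat_span G \<subseteq> nat_span H"
proof
  show "a \<in> nat_span H" if "a \<in> nat_span G" for a
    using that assms by induction (auto intro: nat_span.intros)
qed

lemma nat_span_empty: "nat_span {} = {0}"
proof
  show "nat_span {} \<subseteq> {0}"
    using nat_span.cases by blast
qed (simp add: zero_in_nat_span)

lemma nat_span_Un: "nat_span (G \<union> H) = nat_span G + nat_span H"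
proof
  show "nat_span (G \<union> H) \<subseteq> nat_span G + nat_span H"
  proof
    fix a assume "a \<in> nat_span (G \<union> H)"
    then show "a \<in> nat_span G + nat_span H"
    proof induction
      case zero_in_nat_span
      show ?case
        using set_plus_intro[OF nat_span.zero_in_nat_span nat_span.zero_in_nat_span] by force
    next
      case (generator_plus_in_nat_span g a)
      then obtain b c where bc: "a = b + c" "b \<in> nat_span G" "c \<in> nat_span H"
        by (auto elim: set_plus_elim)
      show ?case
      proof (cases "g \<in> G")
        case True
        then show ?thesis
          using set_plus_intro[OF nat_span.generator_plus_in_nat_span bc(3)] bc
          by (metis add.assoc)
      next
        case False
        then have "g \<in> H"
          using generator_plus_in_nat_span by simp
        then show ?thesis
          using set_plus_intro[OF bc(2) nat_span.generator_plus_in_nat_span] bc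
          by (metis add.left_commute)
      qed
    qed
  qed
  show "nat_span G + nat_span H \<subseteq> nat_span (G \<union> H)"
    using nat_span_mono[of G "G \<union> H"] nat_span_mono[of H "G \<union> H"]
    by (auto elim!: set_plus_elim intro!: nat_span_add)
qed

definition nat_multiple :: "nat \<Rightarrow> 'a::comm_monoid_add \<Rightarrow> 'a" where
  "nat_multiple n a = (\<Sum>i<n. a)"

lemma nat_multiple_0 [simp]: "nat_multiple 0 a = 0"
  and nat_multiple_Suc [simp]: "nat_multiple (Suc n) a = a + nat_multiple n a"
  by (simp_all add: nat_multiple_def add.commute)

lemma nat_multiple_add: "nat_multiple (m + n) a = nat_multiple m a + nat_multiple n a"
  by (induction m) (simp_all add: add.assoc)

lemma nat_multiple_mult: "nat_multiple (m * n) a = nat_multiple m (nat_multiple n a)"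
  by (induction m) (simp_all add: nat_multiple_add)

lemma nat_multiple_Pair: "nat_multiple n (a, b) = (nat_multiple n a, nat_multiple n b)"
  by (induction n) (simp_all add: zero_prod_def)

lemma nat_multiple_scaleR: "nat_multiple n a = real n *\<^sub>R a" for a :: "'a::real_vector"
  by (induction n) (simp_all add: scaleR_add_left)

lemma nat_multiple_nat: "nat_multiple n (k::nat) = n * k"
  by (induction n) simp_all

lemma nat_multiple_in_nat_span: "a \<in> nat_span G \<Longrightarrow> nat_multiple n a \<in> nat_span G"
  by (simp add: nat_multiple_def nat_span_sum)

lemma nat_span_singleton: "nat_span {g} = range (\<lambda>n. nat_multiple n g)"
proof
  show "nat_span {g} \<subseteq> range (\<lambda>n. nat_multiple n g)"
  proof
    fix a assume "a \<in> nat_span {g}"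
    then show "a \<in> range (\<lambda>n. nat_multiple n g)"
    proof induction
      case zero_in_nat_span
      show ?case by (rule range_eqI[of _ _ 0]) simp
    next
      case (generator_plus_in_nat_span g' a)
      then show ?case by (auto intro: range_eqI[of _ _ "Suc _"])
    qed
  qed
qed (auto intro: nat_multiple_in_nat_span nat_span_base)

lemma nat_span_singleton_unfold: "nat_span {g} = {0} \<union> ({g} + nat_span {g})"
proof
  show "nat_span {g} \<subseteq> {0} \<union> ({g} + nat_span {g})"
    by (auto elim: nat_span.cases)
qed (auto intro: nat_span.intros elim!: set_plus_elim)

lemma nat_span_singleton_plus_unfold:
  "nat_span {g} + A = A \<union> ({g} + (nat_span {g} + A))"
  by (subst nat_span_singleton_unfold) (simp only: Un_set_plus set_add_0 add.assoc)

lemma nat_span_insert: "nat_span (insert g G) = range (\<lambda>n. nat_multiple n g) + nat_span G"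
  using nat_span_Un[of "{g}" G] by (simp add: nat_span_singleton)

lemma nat_span_plus_nat_span: "nat_span G + nat_span G = nat_span G"
  using nat_span_Un[of G G] by simp

lemma set_plus_UN_distrib: "(\<Union>i\<in>I. A i) + B = (\<Union>i\<in>I. A i + B)"
  for A :: "'i \<Rightarrow> 'a::plus set"
  by (auto simp: set_plus_def)

definition finitely_generated :: "'a::comm_monoid_add set \<Rightarrow> 'a set \<Rightarrow> bool" where
  "finitely_generated G A \<longleftrightarrow> (\<exists>F. finite F \<and> A = F + nat_span G)"

lemma finitely_generatedI: "finite F \<Longrightarrow> finitely_generated G (F + nat_span G)"
  unfolding finitely_generated_def by blast

lemma finitely_generatedE:
  assumes "finitely_generated G A"
  obtains F where "finite F" "A = F + nat_span G"
  using assms unfolding finitely_generated_def by blast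

lemma finitely_generated_nat_span: "finitely_generated G (nat_span G)"
  using finitely_generatedI[of "{0}" G] by simp

lemma finitely_generated_finite_plus:
  assumes "finite F" "finitely_generated G A"
  shows "finitely_generated G (F + A)"
proof -
  obtain F' where "finite F'" "A = F' + nat_span G"
    using assms(2) by (rule finitely_generatedE)
  then show ?thesis
    using finitely_generatedI[of "F + F'" G] assms(1) by (simp add: finite_set_plus add.assoc)
qed

lemma finitely_generated_plus_nat_span:
  assumes "finitely_generated G A"
  shows "finitely_generated (G \<union> H) (A + nat_span H)"
proof -
  obtain F where "finite F" "A = F + nat_span G"
    using assms by (rule finitely_generatedE)
  then show ?thesis
    using finitely_generatedI[of F "G \<union> H"] by (simp add: nat_span_Un add.assoc)
qed

lemma finitely_generated_closed: "finitely_generated G A \<Longrightarrow> A + nat_span G = A"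
  by (auto simp: add.assoc nat_span_plus_nat_span elim!: finitely_generatedE)

lemma finitely_generated_insertE:
  assumes "finitely_generated (insert g G) A"
  obtains A\<^sub>0 where "finitely_generated G A\<^sub>0" "A = nat_span {g} + A\<^sub>0"
proof -
  obtain F where F: "finite F" "A = F + nat_span (insert g G)"
    using assms by (rule finitely_generatedE)
  then have "A = nat_span {g} + (F + nat_span G)"
    using nat_span_Un[of "{g}" G] by (simp add: add.left_commute)
  then show thesis
    using that finitely_generatedI[OF F(1)] by blast
qed

lemma finitely_generated_UN:
  assumes "finite I" "\<And>i. i \<in> I \<Longrightarrow> finitely_generated G (A i)"
  shows "finitely_generated G (\<Union>i\<in>I. A i)"
proof -
  obtain F where F: "i \<in> I \<Longrightarrow> finite (F i)" "i \<in> I \<Longrightarrow> A i = F i + nat_span G" for i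
    using assms(2) unfolding finitely_generated_def by metis
  have "(\<Union>i\<in>I. A i) = (\<Union>i\<in>I. F i) + nat_span G"
    by (simp add: F(2) set_plus_UN_distrib)
  then show ?thesis
    using assms(1) F(1) by (simp add: finitely_generatedI)
qed

lemma finitely_generated_nat_span_of_multiples:
  assumes "finite H" "\<And>h. h \<in> H \<Longrightarrow> \<exists>k>0. nat_multiple k h \<in> nat_span G"
  shows "finitely_generated G (nat_span (H \<union> G))"
  using assms
proof (induction H rule: finite_induct)
  case empty
  show ?case
    by (simp add: finitely_generated_nat_span)
next
  case (insert h H)
  let ?R = "\<lambda>I. (\<lambda>r. nat_multiple r h) ` I" and ?S = "nat_span (H \<union> G)"
  obtain k where k: "k > 0" "nat_multiple k h \<in> nat_span G"
    using insert.prems by blast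
  have k_multiple: "nat_multiple (n div k * k) h \<in> ?S" for n
    using k(2) nat_span_mono[of G "H \<union> G"]
    unfolding nat_multiple_mult by (blast intro: nat_multiple_in_nat_span)
  have "nat_multiple n h + a \<in> ?R {..<k} + ?S" if "a \<in> ?S" for n a
  proof -
    have "nat_multiple n h + a = nat_multiple (n mod k) h + (nat_multiple (n div k * k) h + a)"
      by (simp flip: add.assoc nat_multiple_add)
    then show ?thesis
      using k(1) k_multiple[of n] that by (auto intro: nat_span_add)
  qed
  then have "?R UNIV + ?S = ?R {..<k} + ?S"
    by (auto elim!: set_plus_elim)
  then have "nat_span (insert h H \<union> G) = ?R {..<k} + ?S"
    by (simp add: nat_span_insert)
  then show ?case
    using insert.IH insert.prems by (simp add: finitely_generated_finite_plus)
qed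

lemma finitely_generated_UN_chain:
  assumes "finitely_generated G (\<Union>n. C n)" "mono (C :: nat \<Rightarrow> _)" "\<And>n. C n + nat_span G \<subseteq> C n"
  obtains N where "(\<Union>n. C n) = C N"
proof -
  obtain F where F: "finite F" "(\<Union>n. C n) = F + nat_span G"
    using assms(1) by (rule finitely_generatedE)
  have "F \<subseteq> (\<Union>n. C n)"
    unfolding F(2) using set_plus_intro[OF _ zero_in_nat_span] by fastforce
  then have "\<forall>f\<in>F. \<exists>n. f \<in> C n"
    by blast
  then obtain N where "\<forall>f\<in>F. \<exists>n\<le>N. f \<in> C n"
    using finite_indexed_bound[OF F(1), of "\<lambda>f n. f \<in> C n"] by blast
  then have "F \<subseteq> C N"
    using monoD[OF assms(2)] by blast
  then have "F + nat_span G \<subseteq> C N"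
    by (rule order_trans[OF set_plus_mono2[OF _ order_refl] assms(3)])
  then show thesis
    using F(2) that[of N] by blast
qed

definition graded_piece :: "'a::comm_monoid_add \<Rightarrow> 'a set \<Rightarrow> 'a set \<Rightarrow> nat \<Rightarrow> 'a set" where
  "graded_piece g A B n = {b \<in> B. nat_multiple n g + b \<in> A}"

lemma mono_graded_piece:
  assumes "A + nat_span {g} \<subseteq> A"
  shows "mono (graded_piece g A B)"
proof -
  have "graded_piece g A B n \<subseteq> graded_piece g A B (Suc n)" for n
  proof
    fix b assume b: "b \<in> graded_piece g A B n"
    then have "nat_multiple n g + b + g \<in> A"
      using assms nat_span_base[of g "{g}"] by (auto simp: graded_piece_def)
    then show "b \<in> graded_piece g A B (Suc n)"
      using b by (simp add: graded_piece_def add_ac)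
  qed
  then show ?thesis
    by (simp add: mono_iff_le_Suc)
qed

lemma graded_piece_closed:
  assumes "A + nat_span G \<subseteq> A" "B + nat_span G \<subseteq> B"
  shows "graded_piece g A B n + nat_span G \<subseteq> graded_piece g A B n"
proof (clarify elim!: set_plus_elim)
  fix b c assume "b \<in> graded_piece g A B n" "c \<in> nat_span G"
  then have "nat_multiple n g + b + c \<in> A" "b + c \<in> B"
    using assms by (auto simp: graded_piece_def)
  then show "b + c \<in> graded_piece g A B n"
    by (simp add: graded_piece_def add.assoc)
qed

lemma graded_pieces_generate:
  assumes "A \<subseteq> nat_span {g} + B" "A + nat_span {g} \<subseteq> A"
    and "(\<Union>n. graded_piece g A B n) = graded_piece g A B N"
  shows "A = (\<Union>n\<le>N. {nat_multiple n g} + graded_piece g A B n) + nat_span {g}" (is "A = ?A + _")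
proof
  show "A \<subseteq> ?A + nat_span {g}"
  proof
    fix a assume "a \<in> A"
    then obtain n b where a: "a = nat_multiple n g + b" "b \<in> B"
      using assms(1) by (auto simp: nat_span_singleton elim!: set_plus_elim)
    define m where "m = min n N"
    have "b \<in> graded_piece g A B n"
      using a \<open>a \<in> A\<close> by (simp add: graded_piece_def)
    then have "b \<in> graded_piece g A B m"
      using assms(3) by (auto simp: m_def min_def)
    then have "nat_multiple m g + b \<in> ?A"
      by (auto simp: m_def)
    moreover have "nat_multiple n g = nat_multiple m g + nat_multiple (n - m) g"
      by (simp add: m_def flip: nat_multiple_add)
    then have "a = nat_multiple m g + b + nat_multiple (n - m) g"
      by (simp add: a(1) add_ac)
    ultimately show "a \<in> ?A + nat_span {g}"
      by (auto simp: nat_span_singleton)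
  qed
  have "?A \<subseteq> A"
    by (auto simp: graded_piece_def elim!: set_plus_elim)
  then show "?A + nat_span {g} \<subseteq> A"
    using assms(2) by (rule order_trans[OF set_plus_mono2[OF _ order_refl]])
qed

text \<open>
  Hilbert's basis theorem. The graded pieces play the role of the ideals of leading coefficients.
\<close>

theorem finitely_generated_subset:
  assumes "finite G" "finitely_generated G B" "A \<subseteq> B" "A + nat_span G \<subseteq> A"
  shows "finitely_generated G A"
  using assms
proof (induction G arbitrary: A B rule: finite_induct)
  case empty
  then show ?case
    by (auto simp: finitely_generated_def nat_span_empty intro: finite_subset)
next
  case (insert g G)
  obtain B\<^sub>0 where B\<^sub>0: "finitely_generated G B\<^sub>0" "B = nat_span {g} + B\<^sub>0"
    using insert.prems(1) by (rule finitely_generated_insertE)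
  have closed: "A + nat_span H \<subseteq> A" if "H \<subseteq> insert g G" for H
    using insert.prems(3) by (rule order_trans[OF set_plus_mono2[OF order_refl nat_span_mono[OF that]]])
  let ?C = "graded_piece g A B\<^sub>0"
  have C_closed: "?C n + nat_span G \<subseteq> ?C n" for n
    using finitely_generated_closed[OF B\<^sub>0(1)] by (intro graded_piece_closed closed) auto
  have C_subset: "?C n \<subseteq> B\<^sub>0" for n
    by (auto simp: graded_piece_def)
  have C: "finitely_generated G (?C n)" for n
    using insert.IH[OF B\<^sub>0(1) C_subset C_closed] .
  have "(\<Union>n. ?C n) + nat_span G \<subseteq> (\<Union>n. ?C n)"
    unfolding set_plus_UN_distrib using C_closed by (intro UN_mono) auto
  then have "finitely_generated G (\<Union>n. ?C n)"
    using C_subset by (intro insert.IH[OF B\<^sub>0(1)]) auto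
  then obtain N where N: "(\<Union>n. ?C n) = ?C N"
    using finitely_generated_UN_chain mono_graded_piece[OF closed] C_closed by blast
  have "A = (\<Union>n\<le>N. {nat_multiple n g} + ?C n) + nat_span {g}"
    using insert.prems(2) B\<^sub>0(2) N by (intro graded_pieces_generate closed) auto
  moreover have "finitely_generated G (\<Union>n\<le>N. {nat_multiple n g} + ?C n)"
    using C by (intro finitely_generated_UN finitely_generated_finite_plus) auto
  ultimately show ?case
    using finitely_generated_plus_nat_span[of G _ "{g}"] by (metis Un_insert_right sup_bot_right)
qed

section \<open>Hilbert series\<close>

definition hilbert_series :: "('a \<Rightarrow> nat) \<Rightarrow> 'a set \<Rightarrow> complex fps" where
  "hilbert_series deg A = Abs_fps (\<lambda>d. of_nat (card {a \<in> A. deg a = d}))"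

lemma hilbert_series_nth [simp]:
  "fps_nth (hilbert_series deg A) d = of_nat (card {a \<in> A. deg a = d})"
  by (simp add: hilbert_series_def)

lemma hilbert_series_Diff:
  assumes "A \<subseteq> B" "\<And>d. finite {b \<in> B. deg b = d}"
  shows "hilbert_series deg (B - A) = hilbert_series deg B - hilbert_series deg A"
proof (rule fps_ext)
  fix d
  have "{b \<in> B - A. deg b = d} = {b \<in> B. deg b = d} - {a \<in> A. deg a = d}"
    by auto
  moreover have "{a \<in> A. deg a = d} \<subseteq> {b \<in> B. deg b = d}"
    using assms(1) by auto
  ultimately show "fps_nth (hilbert_series deg (B - A)) d
      = fps_nth (hilbert_series deg B - hilbert_series deg A) d"
    using assms(2) by (simp add: card_Diff_subset card_mono finite_subset of_nat_diff)
qed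

lemma hilbert_series_finite:
  assumes "finite A"
  shows "hilbert_series deg A = fps_of_poly (\<Sum>a\<in>A. monom 1 (deg a))"
  using assms by (intro fps_ext) (simp add: coeff_sum sum.If_cases Int_def)

lemma range_fps_of_poly_diff:
  fixes P Q :: "'a::ab_group_add fps"
  shows "P \<in> range fps_of_poly \<Longrightarrow> Q \<in> range fps_of_poly \<Longrightarrow> P - Q \<in> range fps_of_poly"
  by (auto simp flip: fps_of_poly_diff)

lemma range_fps_of_poly_sum:
  fixes P :: "'i \<Rightarrow> 'a::comm_monoid_add fps"
  assumes "\<And>i. i \<in> I \<Longrightarrow> P i \<in> range fps_of_poly"
  shows "sum P I \<in> range fps_of_poly"
proof -
  have "\<forall>i\<in>I. \<exists>p. P i = fps_of_poly p"
    using assms by blast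
  then obtain p where "\<forall>i\<in>I. P i = fps_of_poly (p i)"
    by metis
  then have "sum P I = fps_of_poly (sum p I)"
    by (simp add: fps_of_poly_sum)
  then show ?thesis by simp
qed

lemma prod_one_minus_fps_X_power_neq_0:
  assumes "\<And>v. v \<in> S \<Longrightarrow> w v > 0"
  shows "(\<Prod>v\<in>S. 1 - fps_X ^ w v) \<noteq> (0 :: 'a::idom fps)"
proof -
  have "fps_nth (\<Prod>v\<in>S. 1 - fps_X ^ w v :: 'a fps) 0 = 1"
    using assms by (induction S rule: infinite_finite_induct) auto
  then show ?thesis by auto
qed

locale graded_monoid =
  fixes deg :: "'a::cancel_comm_monoid_add \<Rightarrow> nat"
  assumes deg_add: "deg (a + b) = deg a + deg b"
begin

lemma finite_nat_span_degree_le: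
  assumes "finite G" "\<And>g. g \<in> G \<Longrightarrow> deg g > 0"
  shows "finite {a \<in> nat_span G. deg a \<le> d}"
proof (induction d rule: less_induct)
  case (less d)
  let ?A = "\<lambda>g. {a \<in> nat_span G. deg a \<le> d - deg g \<and> deg g \<le> d}"
  have "{a \<in> nat_span G. deg a \<le> d} \<subseteq> insert 0 (\<Union>g\<in>G. (+) g ` ?A g)"
  proof clarify
    fix a assume "a \<in> nat_span G" "deg a \<le> d" "a \<notin> (\<Union>g\<in>G. (+) g ` ?A g)"
    then show "a = 0"
      by cases (auto simp: deg_add)
  qed
  moreover have "finite (?A g)" if "g \<in> G" for g
    using less.IH[of "d - deg g"] assms(2)[OF that] by (cases "deg g \<le> d") auto
  ultimately show ?case
    using assms(1) by (auto intro: finite_subset)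
qed

lemma finitely_generated_finite_degree:
  assumes "finitely_generated G A" "finite G" "\<And>g. g \<in> G \<Longrightarrow> deg g > 0"
  shows "finite {a \<in> A. deg a = d}"
proof -
  obtain F where F: "finite F" "A = F + nat_span G"
    using assms(1) by (rule finitely_generatedE)
  have "{a \<in> A. deg a = d} \<subseteq> F + {a \<in> nat_span G. deg a \<le> d}"
    by (auto simp: F(2) deg_add elim!: set_plus_elim)
  then show ?thesis
    by (rule finite_subset) (intro finite_set_plus F(1) finite_nat_span_degree_le assms(2,3))
qed

lemma hilbert_series_translate:
  "hilbert_series deg ({g} + A) = fps_X ^ deg g * hilbert_series deg A"
proof (rule fps_ext)
  fix d
  have "{b \<in> {g} + A. deg b = d} = (+) g ` {a \<in> A. deg g + deg a = d}"
    by (auto simp: set_plus_image deg_add)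
  then have "card {b \<in> {g} + A. deg b = d} = card {a \<in> A. deg g + deg a = d}"
    by (simp add: card_image)
  moreover have "{a \<in> A. deg g + deg a = d} = (if d < deg g then {} else {a \<in> A. deg a = d - deg g})"
    by auto
  ultimately show "fps_nth (hilbert_series deg ({g} + A)) d
      = fps_nth (fps_X ^ deg g * hilbert_series deg A) d"
    by (simp add: fps_X_power_mult_nth)
qed

text \<open>
  Multiplication by \<open>1 - t\<^bsup>deg g\<^esup>\<close> leaves the elements outside \<open>g + B\<close>. By Hilbert's basis
  theorem these are a difference of two sets that are finitely generated without \<open>g\<close>.
\<close>

theorem hilbert_series_finitely_generated:
  assumes "finite G" "\<And>g. g \<in> G \<Longrightarrow> deg g > 0" "finitely_generated G B"
  shows "hilbert_series deg B * (\<Prod>g\<in>G. 1 - fps_X ^ deg g) \<in> range fps_of_poly"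
  using assms
proof (induction G arbitrary: B rule: finite_induct)
  case empty
  then have "finite B"
    by (auto simp: finitely_generated_def nat_span_empty)
  then show ?case
    by (simp add: hilbert_series_finite)
next
  case (insert g G)
  let ?H = "hilbert_series deg" and ?D = "\<Prod>g\<in>G. 1 - fps_X ^ deg g :: complex fps"
  obtain B\<^sub>0 where B\<^sub>0: "finitely_generated G B\<^sub>0" "B = nat_span {g} + B\<^sub>0"
    using insert.prems(2) by (rule finitely_generated_insertE)
  have B: "B = B\<^sub>0 \<union> ({g} + B)"
    unfolding B\<^sub>0(2) by (rule nat_span_singleton_plus_unfold)
  define C where "C = B\<^sub>0 \<inter> ({g} + B)"
  have "C + nat_span G \<subseteq> C"
    using finitely_generated_closed[OF B\<^sub>0(1)]
      finitely_generated_closed[OF insert.prems(2)] nat_span_mono[of G "insert g G"]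
    by (force simp: C_def add.assoc elim!: set_plus_elim)
  then have C: "finitely_generated G C" "C \<subseteq> B\<^sub>0"
    using finitely_generated_subset[OF insert.hyps(1) B\<^sub>0(1), of C] by (auto simp: C_def)
  have degrees: "finite {b \<in> B. deg b = d}" "finite {b \<in> B\<^sub>0. deg b = d}" for d
    using finitely_generated_finite_degree insert.hyps(1) insert.prems B\<^sub>0(1) by blast+
  have "?H B * (1 - fps_X ^ deg g) = ?H B - ?H ({g} + B)"
    by (simp add: hilbert_series_translate right_diff_distrib mult.commute)
  also have "\<dots> = ?H (B - ({g} + B))"
    using B by (intro hilbert_series_Diff[symmetric] degrees) blast
  also have "B - ({g} + B) = B\<^sub>0 - C"
    using B by (auto simp: C_def)
  also have "?H (B\<^sub>0 - C) = ?H B\<^sub>0 - ?H C"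
    by (intro hilbert_series_Diff degrees C)
  finally have "?H B * (1 - fps_X ^ deg g) * ?D = ?H B\<^sub>0 * ?D - ?H C * ?D"
    by (simp only: left_diff_distrib)
  moreover have "?H B\<^sub>0 * ?D \<in> range fps_of_poly" "?H C * ?D \<in> range fps_of_poly"
    using insert.IH insert.prems(1) B\<^sub>0(1) C(1) by simp_all
  ultimately show ?case
    using insert.hyps by (simp add: range_fps_of_poly_diff flip: mult.assoc)
qed

end

section \<open>Quasi-polynomials\<close>

lemma poly_antidifference:
  fixes a :: "'a::field_char_0"
  assumes "a \<noteq> 0"
  obtains R where "\<And>x. poly R x - poly R (x - a) = poly Q x"
proof -
  have "\<exists>R. \<forall>x. poly R x - poly R (x - a) = poly Q x" if "\<forall>i\<ge>n. coeff Q i = 0" for n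
    using that
  proof (induction n arbitrary: Q)
    case 0
    then have "Q = 0"
      by (intro poly_eqI) simp
    then show ?case
      by (intro exI[of _ 0]) simp
  next
    case (Suc n)
    define M where "M = monom 1 (Suc n) - [:- a, 1:] ^ Suc n"
    have poly_M: "poly M x = x ^ Suc n - (x - a) ^ Suc n" for x
      by (simp add: M_def poly_monom del: power_Suc)
    have coeff_M: "coeff M i = (if i \<le> n then - of_nat (Suc n choose i) * (- a) ^ (Suc n - i) else 0)" for i
      by (auto simp: M_def coeff_linear_poly_power coeff_eq_0 degree_linear_power not_le le_Suc_eq
          simp del: power_Suc binomial_Suc_Suc)
    define s where "s = coeff Q n / coeff M n"
    have "coeff M n \<noteq> 0"
      using assms by (simp add: coeff_M del: of_nat_Suc)
    moreover have "coeff M i = 0" if "i > n" for i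
      using that by (simp add: coeff_M)
    ultimately have "coeff (Q - smult s M) i = 0" if "i \<ge> n" for i
      using Suc.prems that by (cases "i = n") (simp_all add: s_def)
    then obtain R where R: "poly R x - poly R (x - a) = poly (Q - smult s M) x" for x
      using Suc.IH by blast
    have "poly (R + smult s (monom 1 (Suc n))) x - poly (R + smult s (monom 1 (Suc n))) (x - a)
        = poly Q x" for x
      using R[of x] by (simp add: poly_M poly_monom algebra_simps)
    then show ?case by blast
  qed
  from this[of "Suc (degree Q)"] show thesis
    using that by (auto simp: coeff_eq_0)
qed

lemma has_quasi_period_antidifference:
  assumes "has_quasi_period h N" "\<And>m. h (m + N) = g (m + N) - g m"
  shows "has_quasi_period g N"
proof -
  have "N > 0"
    using assms(1) by (simp add: has_quasi_period_def)
  have "\<exists>R. \<forall>\<^sub>F m in sequentially. m mod N = j \<longrightarrow> g m = poly R (of_nat m)" if "j < N" for j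
  proof -
    obtain Q M where Q: "\<And>m. m \<ge> M \<Longrightarrow> m mod N = j \<Longrightarrow> h m = poly Q (of_nat m)"
      using assms(1) \<open>j < N\<close> unfolding has_quasi_period_def eventually_sequentially by blast
    obtain R where R: "\<And>x. poly R x - poly R (x - of_nat N) = poly Q x"
      using poly_antidifference[of "of_nat N :: complex" Q] \<open>N > 0\<close> by auto
    define m\<^sub>0 where "m\<^sub>0 = j + N * M"
    have m\<^sub>0: "m\<^sub>0 \<ge> M" "m\<^sub>0 mod N = j"
      using \<open>N > 0\<close> \<open>j < N\<close> by (auto simp: m\<^sub>0_def trans_le_add2)
    define c where "c = g m\<^sub>0 - poly R (of_nat m\<^sub>0)"
    have "g (m\<^sub>0 + i * N) = poly (R + [:c:]) (of_nat (m\<^sub>0 + i * N))" for i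
    proof (induction i)
      case (Suc i)
      let ?m = "m\<^sub>0 + i * N"
      have "g (?m + N) = g ?m + poly Q (of_nat (?m + N))"
        using assms(2)[of ?m] Q[of "?m + N"] m\<^sub>0 by (simp add: algebra_simps)
      also have "\<dots> = poly (R + [:c:]) (of_nat (?m + N))"
        using R[of "of_nat (?m + N)"] Suc by (simp add: algebra_simps)
      finally show ?case
        by (simp add: add.assoc add.commute[of N])
    qed (simp add: c_def)
    moreover have "\<exists>i. m = m\<^sub>0 + i * N" if "m \<ge> m\<^sub>0" "m mod N = j" for m
      using that m\<^sub>0(2) by (metis le_add_diff_inverse mod_eq_dvd_iff_nat dvd_div_mult_self)
    ultimately show ?thesis
      unfolding eventually_sequentially by metis
  qed
  then obtain R where "\<forall>j<N. \<forall>\<^sub>F m in sequentially. m mod N = j \<longrightarrow> g m = poly (R j) (of_nat m)"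
    by metis
  then show ?thesis
    using \<open>N > 0\<close> by (auto simp: has_quasi_period_def)
qed

lemma has_quasi_period_power_denominator:
  assumes "N > 0" "H * (1 - fps_X ^ N) ^ k = fps_of_poly P"
  shows "has_quasi_period (fps_nth H) N"
  using assms(2)
proof (induction k arbitrary: H)
  case 0
  have "\<forall>\<^sub>F m in sequentially. fps_nth H m = 0"
    using eventually_gt_at_top[of "degree P"]
    by eventually_elim (use 0 in \<open>simp add: coeff_eq_0\<close>)
  then show ?case
    using assms(1) unfolding has_quasi_period_def
    by (intro conjI exI[of _ "\<lambda>_. 0"]) (auto elim: eventually_mono)
next
  case (Suc k)
  then have "has_quasi_period (fps_nth (H * (1 - fps_X ^ N))) N"
    by (simp add: mult.assoc)
  then show ?case
    by (rule has_quasi_period_antidifference)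
       (simp add: right_diff_distrib fps_X_power_mult_right_nth)
qed

lemma one_minus_monom_dvd:
  assumes "w dvd N"
  shows "1 - monom 1 w dvd (1 - monom 1 N :: 'a::comm_ring_1 poly)"
proof -
  obtain k where "N = w * k"
    using assms by (rule dvdE)
  then have "1 - monom (1::'a) N = 1 - monom 1 w ^ k"
    by (simp add: monom_power)
  then show ?thesis
    by (simp add: one_diff_power_eq)
qed

lemma has_quasi_period_prod_denominator:
  assumes "N > 0" "\<And>v. v \<in> S \<Longrightarrow> w v dvd N"
    and "H * (\<Prod>v\<in>S. 1 - fps_X ^ w v) \<in> range fps_of_poly"
  shows "has_quasi_period (fps_nth H) N"
proof -
  have "(\<Prod>v\<in>S. 1 - monom 1 (w v)) dvd (\<Prod>v\<in>S. 1 - monom 1 N :: complex poly)"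
    by (intro prod_dvd_prod one_minus_monom_dvd assms(2))
  then obtain E where "(1 - monom 1 N) ^ card S = (\<Prod>v\<in>S. 1 - monom 1 (w v)) * (E :: complex poly)"
    by (auto elim: dvdE)
  from arg_cong[OF this, of fps_of_poly]
  have E: "(1 - fps_X ^ N) ^ card S = (\<Prod>v\<in>S. 1 - fps_X ^ w v) * fps_of_poly E"
    by (simp add: fps_of_poly_power fps_of_poly_diff fps_of_poly_mult fps_of_poly_prod fps_of_poly_monom')
  obtain P where "H * (\<Prod>v\<in>S. 1 - fps_X ^ w v) = fps_of_poly P"
    using assms(3) by blast
  then have "H * (1 - fps_X ^ N) ^ card S = fps_of_poly (P * E)"
    by (simp add: E fps_of_poly_mult flip: mult.assoc)
  then show ?thesis
    by (rule has_quasi_period_power_denominator[OF assms(1)])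
qed

section \<open>Lattices\<close>

lemma independent_coefficient_bound:
  fixes B :: "'l::euclidean_space set"
  assumes "independent B"
  obtains K where "\<And>c b. b \<in> B \<Longrightarrow> \<bar>c b\<bar> \<le> K * norm (\<Sum>b\<in>B. c b *\<^sub>R b)"
proof -
  have "finite B"
    using assms by (rule independent_imp_finite)
  have "\<exists>K\<ge>0. \<forall>c. \<bar>c b\<bar> \<le> K * norm (\<Sum>b\<in>B. c b *\<^sub>R b)" if "b \<in> B" for b
  proof -
    obtain f :: "'l \<Rightarrow> real" where f: "linear f" "\<forall>x\<in>B. f x = (if x = b then 1 else 0)"
      using linear_independent_extend[OF assms, of "\<lambda>x. if x = b then 1 else 0"] by blast
    have "f (\<Sum>b\<in>B. c b *\<^sub>R b) = c b" for c
    proof -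
      have "f (\<Sum>b\<in>B. c b *\<^sub>R b) = (\<Sum>x\<in>B. if x = b then c x else 0)"
        using f by (simp add: linear_sum linear_cmul) (auto intro: sum.cong)
      then show ?thesis
        using \<open>b \<in> B\<close> \<open>finite B\<close> by simp
    qed
    moreover obtain K where "K > 0" "\<And>x. norm (f x) \<le> K * norm x"
      using linear_bounded_pos[OF f(1)] by blast
    ultimately show ?thesis
      by (metis less_imp_le real_norm_def)
  qed
  then obtain K where K: "b \<in> B \<Longrightarrow> K b \<ge> 0"
      "b \<in> B \<Longrightarrow> \<bar>c b\<bar> \<le> K b * norm (\<Sum>b\<in>B. c b *\<^sub>R b)" for b c
    by metis
  have "\<bar>c b\<bar> \<le> sum K B * norm (\<Sum>b\<in>B. c b *\<^sub>R b)" if "b \<in> B" for c b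
    using K that \<open>finite B\<close> by (intro order_trans[OF K(2)] mult_right_mono member_le_sum) auto
  then show thesis
    using that by blast
qed

lemma finite_lattice_cball:
  assumes "lattice_of_rank n L"
  shows "finite (L \<inter> cball 0 r)"
proof -
  obtain B where B: "independent B" and L: "L = {\<Sum>b\<in>B. real_of_int (c b) *\<^sub>R b | c. True}"
    using assms by (auto simp: lattice_of_rank_def)
  obtain K where K: "\<And>c b. b \<in> B \<Longrightarrow> \<bar>c b\<bar> \<le> K * norm (\<Sum>b\<in>B. c b *\<^sub>R b)"
    using independent_coefficient_bound[OF B] by blast
  let ?C = "PiE B (\<lambda>_. {- \<lceil>\<bar>K\<bar> * r\<rceil>..\<lceil>\<bar>K\<bar> * r\<rceil>})"
  have "L \<inter> cball 0 r \<subseteq> (\<lambda>c. \<Sum>b\<in>B. real_of_int (c b) *\<^sub>R b) ` ?C"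
  proof
    fix x assume x: "x \<in> L \<inter> cball 0 r"
    then obtain c where c: "x = (\<Sum>b\<in>B. real_of_int (c b) *\<^sub>R b)"
      by (auto simp: L)
    have "c b \<in> {- \<lceil>\<bar>K\<bar> * r\<rceil>..\<lceil>\<bar>K\<bar> * r\<rceil>}" if "b \<in> B" for b
    proof -
      have "\<bar>real_of_int (c b)\<bar> \<le> K * norm x"
        unfolding c using K[OF that] .
      also have "\<dots> \<le> \<bar>K\<bar> * r"
        using x by (intro mult_mono) auto
      finally show ?thesis
        unfolding atLeastAtMost_iff by linarith
    qed
    then show "x \<in> (\<lambda>c. \<Sum>b\<in>B. real_of_int (c b) *\<^sub>R b) ` ?C"
      by (intro image_eqI[of _ _ "restrict c B"]) (simp_all add: c)
  qed
  moreover have "finite ?C"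
    using B by (intro finite_PiE independent_imp_finite) auto
  ultimately show ?thesis
    by (rule finite_subset[OF _ finite_imageI])
qed

lemma int_combination_mem:
  fixes \<Lambda> :: "'a::real_vector set"
  assumes \<Lambda>: "0 \<in> \<Lambda>" "\<And>a b. a \<in> \<Lambda> \<Longrightarrow> b \<in> \<Lambda> \<Longrightarrow> a - b \<in> \<Lambda>"
    and g: "\<And>j. j \<in> J \<Longrightarrow> g j \<in> \<Lambda>"
  shows "(\<Sum>j\<in>J. real_of_int (z j) *\<^sub>R g j) \<in> \<Lambda>"
proof -
  have add: "a + b \<in> \<Lambda>" if "a \<in> \<Lambda>" "b \<in> \<Lambda>" for a b
    using \<Lambda>(2)[OF that(1) \<Lambda>(2)[OF \<Lambda>(1) that(2)]] by simp
  have nat: "real n *\<^sub>R a \<in> \<Lambda>" if "a \<in> \<Lambda>" for n a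
    using \<Lambda>(1) that by (induction n) (auto simp: scaleR_add_left intro: add)
  have "real_of_int k *\<^sub>R a \<in> \<Lambda>" if "a \<in> \<Lambda>" for k a
    using nat[OF that] \<Lambda>(2)[OF \<Lambda>(1) nat[OF that]] by (cases k rule: int_cases2) simp_all
  then show ?thesis
    using g by (induction J rule: infinite_finite_induct) (auto intro: add \<Lambda>(1))
qed

text \<open>
  Rounding down the coefficients of the multiples of the given combination leaves remainders in a
  bounded part of \<open>\<Lambda>\<close>, so two of them coincide; the difference of the two multiples is the one sought.
\<close>

lemma discrete_subgroup_cone_multiple:
  fixes \<Lambda> :: "'a::real_normed_vector set"
  assumes discrete: "\<And>r. finite (\<Lambda> \<inter> cball 0 r)"
    and \<Lambda>: "0 \<in> \<Lambda>" "\<And>a b. a \<in> \<Lambda> \<Longrightarrow> b \<in> \<Lambda> \<Longrightarrow> a - b \<in> \<Lambda>"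
    and g: "\<And>j. j \<in> J \<Longrightarrow> g j \<in> \<Lambda>" and u: "\<And>j. j \<in> J \<Longrightarrow> u j \<ge> 0"
    and a: "(\<Sum>j\<in>J. u j *\<^sub>R g j) \<in> \<Lambda>"
  obtains k m where "k > 0" "real k *\<^sub>R (\<Sum>j\<in>J. u j *\<^sub>R g j) = (\<Sum>j\<in>J. real (m j) *\<^sub>R g j)"
proof -
  let ?a = "\<Sum>j\<in>J. u j *\<^sub>R g j"
  define r where "r k = (\<Sum>j\<in>J. frac (real k * u j) *\<^sub>R g j)" for k
  have r_eq: "r k = real k *\<^sub>R ?a - (\<Sum>j\<in>J. real_of_int \<lfloor>real k * u j\<rfloor> *\<^sub>R g j)" for k
    by (simp add: r_def frac_def scaleR_sum_right sum_subtractf scaleR_diff_left)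
  have "r k \<in> \<Lambda> \<inter> cball 0 (\<Sum>j\<in>J. norm (g j))" for k
  proof -
    have "norm (r k) \<le> (\<Sum>j\<in>J. norm (g j))"
      unfolding r_def using frac_lt_1[THEN less_imp_le]
      by (intro order_trans[OF norm_sum] sum_mono) (auto intro!: mult_left_le_one_le)
    moreover have "r k \<in> \<Lambda>"
      unfolding r_eq using int_combination_mem[OF \<Lambda>, of "{()}" "\<lambda>_. ?a" "\<lambda>_. int k"] a
      by (intro \<Lambda>(2) int_combination_mem[OF \<Lambda> g]) auto
    ultimately show ?thesis by simp
  qed
  then have "finite (range r)"
    by (intro finite_subset[OF _ discrete]) blast
  then have "\<not> inj r"
    using finite_imageD infinite_UNIV_nat by blast
  then obtain k l where kl: "k < l" "r k = r l"
    unfolding inj_def by (metis linorder_neqE_nat)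
  define z where "z j = nat (\<lfloor>real l * u j\<rfloor> - \<lfloor>real k * u j\<rfloor>)" for j
  have z: "real (z j) = real_of_int \<lfloor>real l * u j\<rfloor> - real_of_int \<lfloor>real k * u j\<rfloor>" if "j \<in> J" for j
  proof -
    have "\<lfloor>real k * u j\<rfloor> \<le> \<lfloor>real l * u j\<rfloor>"
      using u[OF that] kl(1) by (intro floor_mono mult_right_mono) auto
    then show ?thesis by (simp add: z_def)
  qed
  have "real (l - k) *\<^sub>R ?a = (\<Sum>j\<in>J. real (z j) *\<^sub>R g j)"
    using kl unfolding r_eq
    by (simp add: z scaleR_diff_left sum_subtractf of_nat_diff algebra_simps cong: sum.cong)
  then show thesis
    using kl(1) that[of "l - k"] by simp
qed

lemma finite_lattice_times_Ints_cball:
  assumes "lattice_of_rank n L"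
  shows "finite ((L \<times> (\<int> :: real set)) \<inter> cball 0 r)"
proof (rule finite_subset)
  show "(L \<times> \<int>) \<inter> cball 0 r \<subseteq> (L \<inter> cball 0 r) \<times> {z \<in> \<int>. - r \<le> z \<and> z \<le> r}"
  proof
    fix p :: "'a \<times> real" assume p: "p \<in> (L \<times> \<int>) \<inter> cball 0 r"
    then have "norm (fst p) \<le> r" "norm (snd p) \<le> r"
      using norm_fst_le[of "fst p" "snd p"] norm_snd_le[of "snd p" "fst p"] by simp_all
    then show "p \<in> (L \<inter> cball 0 r) \<times> {z \<in> \<int>. - r \<le> z \<and> z \<le> r}"
      using p by (auto simp: mem_Times_iff)
  qed
  show "finite ((L \<inter> cball 0 r) \<times> {z \<in> \<int>. - r \<le> z \<and> z \<le> r})"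
    by (intro finite_cartesian_product finite_lattice_cball[OF assms] finite_int_segment)
qed

lemma lattice_cone_multiple_in_nat_span:
  fixes L :: "'l::euclidean_space set" and g :: "'j \<Rightarrow> 'l \<times> nat"
  assumes L: "lattice_of_rank n L"
    and g: "\<And>j. j \<in> J \<Longrightarrow> fst (g j) \<in> L" and u: "\<And>j. j \<in> J \<Longrightarrow> u j \<ge> 0"
    and a: "a \<in> L" "a = (\<Sum>j\<in>J. u j *\<^sub>R fst (g j))"
    and d: "real d = (\<Sum>j\<in>J. u j * real (snd (g j)))"
  shows "\<exists>k>0. nat_multiple k (a, d) \<in> nat_span (g ` J)"
proof -
  define \<Lambda> where "\<Lambda> = L \<times> (\<int> :: real set)"
  let ?g = "\<lambda>j. (fst (g j), real (snd (g j)))"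
  have discrete: "finite (\<Lambda> \<inter> cball 0 r)" for r
    unfolding \<Lambda>_def by (rule finite_lattice_times_Ints_cball[OF L])
  have zero: "0 \<in> \<Lambda>"
    using lattice_of_rank_closed(1)[OF L] by (simp add: \<Lambda>_def zero_prod_def)
  have diff: "x - y \<in> \<Lambda>" if "x \<in> \<Lambda>" "y \<in> \<Lambda>" for x y
    using lattice_of_rank_closed(2)[OF L] that by (auto simp: \<Lambda>_def)
  have generator: "?g j \<in> \<Lambda>" if "j \<in> J" for j
    using g[OF that] by (simp add: \<Lambda>_def)
  have sum_eq: "(\<Sum>j\<in>J. u j *\<^sub>R ?g j) = (a, real d)"
    by (simp add: prod_eq_iff fst_sum snd_sum a(2) d)
  have "(\<Sum>j\<in>J. u j *\<^sub>R ?g j) \<in> \<Lambda>"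
    unfolding sum_eq using a(1) by (simp add: \<Lambda>_def)
  then obtain k m where k: "k > 0"
      "real k *\<^sub>R (\<Sum>j\<in>J. u j *\<^sub>R ?g j) = (\<Sum>j\<in>J. real (m j) *\<^sub>R ?g j)"
    using discrete_subgroup_cone_multiple[of \<Lambda> J ?g u] discrete zero diff generator u by blast
  from k(2) have "real k *\<^sub>R a = (\<Sum>j\<in>J. real (m j) *\<^sub>R fst (g j))"
      and "real (k * d) = real (\<Sum>j\<in>J. m j * snd (g j))"
    unfolding sum_eq by (simp_all add: prod_eq_iff fst_sum snd_sum)
  then have "nat_multiple k (a, d) = (\<Sum>j\<in>J. nat_multiple (m j) (fst (g j), snd (g j)))"
    unfolding of_nat_eq_iff
    by (simp add: nat_multiple_Pair nat_multiple_scaleR nat_multiple_nat prod_eq_iff fst_sum snd_sum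
        del: prod.collapse)
  moreover have "\<dots> \<in> nat_span (g ` J)"
    by (intro nat_span_sum nat_multiple_in_nat_span nat_span_base) simp
  ultimately show ?thesis
    using k(1) by auto
qed

section \<open>Walks in finite digraphs\<close>

abbreviation walk_sum :: "('e \<Rightarrow> 'z::comm_monoid_add) \<Rightarrow> 'e list \<Rightarrow> 'z" where
  "walk_sum f p \<equiv> sum_list (map f p)"

definition (in pre_digraph) cycles_meeting :: "'a set \<Rightarrow> 'b list set" where
  "cycles_meeting X = {c. cycle c \<and> walk_supp G c \<inter> X \<noteq> {}}"

definition (in pre_digraph) cycle_reduction ::
    "('b \<Rightarrow> 'z::comm_monoid_add) \<Rightarrow> 'a set \<Rightarrow> 'b list \<Rightarrow> 'b list \<Rightarrow> bool" where
  "cycle_reduction f X p r \<longleftrightarrow>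
     (\<exists>a\<in>nat_span (walk_sum f ` cycles_meeting X). walk_sum f p = walk_sum f r + a)"

context wf_digraph
begin

lemma cycles_meeting_mono: "X \<subseteq> Y \<Longrightarrow> cycles_meeting X \<subseteq> cycles_meeting Y"
  by (auto simp: cycles_meeting_def)

lemma last_in_awalk_verts: "awalk u p v \<Longrightarrow> v \<in> set (awalk_verts u p)"
  using last_in_set[OF awalk_verts_non_Nil, of u p] by simp

lemma set_awalk_verts_snoc:
  assumes "awalk u p (tail G e)" "e \<in> arcs G"
  shows "set (awalk_verts u (p @ [e])) = insert (head G e) (set (awalk_verts u p))"
  using set_awalk_verts_append[OF assms(1) arc_implies_awalk[OF assms(2)]]
    last_in_awalk_verts[OF assms(1)] by auto

lemma cycle_rotate:
  fixes f :: "'b \<Rightarrow> 'z::comm_monoid_add"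
  assumes "cycle c" "x \<in> walk_supp G c"
  obtains z where "awalk x z x" "walk_sum f z = walk_sum f c"
proof -
  obtain u where u: "awalk u c u" "c \<noteq> []"
    using assms(1) by (auto simp: cycle_def)
  have "x \<in> set (awalk_verts u c)"
    using assms(2) u by (auto simp: walk_supp_def set_awalk_verts)
  then obtain q r where "c = q @ r" "awalk u q x" "awalk x r u"
    using awalk_decomp[OF u(1)] by blast
  then show thesis
    using that[of "r @ q"] by (auto simp: add.commute)
qed

lemma awalk_insert_cycle:
  fixes f :: "'b \<Rightarrow> 'z::comm_monoid_add"
  assumes "awalk u p v" "c \<in> cycles_meeting (set (awalk_verts u p))"
  obtains p' where "awalk u p' v" "set (awalk_verts u p) \<subseteq> set (awalk_verts u p')"
    "walk_sum f p' = walk_sum f c + walk_sum f p"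
proof -
  obtain x where x: "cycle c" "x \<in> walk_supp G c" "x \<in> set (awalk_verts u p)"
    using assms(2) by (auto simp: cycles_meeting_def)
  obtain z where z: "awalk x z x" "walk_sum f z = walk_sum f c"
    using cycle_rotate[OF x(1,2)] by blast
  obtain q r where qr: "p = q @ r" "awalk u q x" "awalk x r v"
    using awalk_decomp[OF assms(1) x(3)] by blast
  have "awalk x (z @ r) v"
    using z(1) qr(3) by (rule awalk_appendI)
  with qr(2) have "awalk u (q @ z @ r) v"
    by (rule awalk_appendI)
  moreover have "set (awalk_verts u p) \<subseteq> set (awalk_verts u (q @ z @ r))"
    using set_awalk_verts_append[OF qr(2) \<open>awalk x (z @ r) v\<close>]
      set_awalk_verts_append[OF z(1) qr(3)] set_awalk_verts_append[OF qr(2,3)] qr(1) by blast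
  moreover have "walk_sum f (q @ z @ r) = walk_sum f c + walk_sum f p"
    by (simp add: qr(1) z(2) add.left_commute)
  ultimately show thesis
    by (rule that)
qed

lemma awalk_insert_cycles:
  fixes f :: "'b \<Rightarrow> 'z::comm_monoid_add"
  assumes "awalk u p v" "a \<in> nat_span (walk_sum f ` cycles_meeting (set (awalk_verts u p)))"
  shows "\<exists>p'. awalk u p' v \<and> set (awalk_verts u p) \<subseteq> set (awalk_verts u p') \<and>
    walk_sum f p' = walk_sum f p + a"
  using assms(2)
proof induction
  case zero_in_nat_span
  then show ?case
    using assms(1) by auto
next
  case (generator_plus_in_nat_span g a)
  then obtain c p' where c: "g = walk_sum f c" "c \<in> cycles_meeting (set (awalk_verts u p))"
    and p': "awalk u p' v" "set (awalk_verts u p) \<subseteq> set (awalk_verts u p')"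
      "walk_sum f p' = walk_sum f p + a"
    by blast
  obtain p'' where "awalk u p'' v" "set (awalk_verts u p') \<subseteq> set (awalk_verts u p'')"
      "walk_sum f p'' = walk_sum f c + walk_sum f p'"
    using awalk_insert_cycle[OF p'(1)] c(2) cycles_meeting_mono[OF p'(2)] by blast
  then show ?case
    using p'(2,3) c(1) by (auto simp: add.left_commute)
qed

lemma cycle_reduction_refl: "cycle_reduction f X p p"
  unfolding cycle_reduction_def using zero_in_nat_span by force

lemma cycle_reduction_mono: "X \<subseteq> Y \<Longrightarrow> cycle_reduction f X p r \<Longrightarrow> cycle_reduction f Y p r"
  unfolding cycle_reduction_def
  by (meson subsetD nat_span_mono image_mono cycles_meeting_mono)

lemma cycle_reduction_append:
  assumes "cycle_reduction f X p r" "cycle_reduction f X p' r'"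
  shows "cycle_reduction f X (p @ p') (r @ r')"
proof -
  let ?S = "nat_span (walk_sum f ` cycles_meeting X)"
  obtain a b where ab: "a \<in> ?S" "b \<in> ?S"
      "walk_sum f p = walk_sum f r + a" "walk_sum f p' = walk_sum f r' + b"
    using assms unfolding cycle_reduction_def by blast
  then have "walk_sum f (p @ p') = walk_sum f (r @ r') + (a + b)"
    by (simp add: add_ac)
  then show ?thesis
    unfolding cycle_reduction_def using nat_span_add[OF ab(1,2)] by blast
qed

lemma cycle_reduction_remove_cycle:
  assumes "cycle_reduction f X p (r @ c)" "c \<in> cycles_meeting X"
  shows "cycle_reduction f X p r"
proof -
  let ?S = "nat_span (walk_sum f ` cycles_meeting X)"
  obtain a where a: "a \<in> ?S" "walk_sum f p = walk_sum f (r @ c) + a"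
    using assms(1) unfolding cycle_reduction_def by blast
  then have "walk_sum f p = walk_sum f r + (walk_sum f c + a)"
    by (simp add: add.assoc)
  moreover have "walk_sum f c + a \<in> ?S"
    using assms(2) a(1) by (blast intro: nat_span.intros)
  ultimately show ?thesis
    unfolding cycle_reduction_def by blast
qed

lemma apath_snoc_cases:
  assumes "apath u p (tail G e)" "e \<in> arcs G"
  obtains (path) "apath u (p @ [e]) (head G e)"
  | (cycle) q r where "p = q @ r" "apath u q (head G e)" "cycle (r @ [e])"
proof -
  let ?v = "head G e"
  have p: "awalk u p (tail G e)" "distinct (awalk_verts u p)"
    using assms(1) by (auto simp: apath_def)
  have e: "awalk (tail G e) [e] ?v"
    using assms(2) by (simp add: arc_implies_awalk)
  show thesis
  proof (cases "?v \<in> set (awalk_verts u p)")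
    case False
    moreover have "tail G e \<in> set (awalk_verts u p)"
      using p(1) by (rule last_in_awalk_verts)
    ultimately have "apath u (p @ [e]) ?v"
      using assms p(1) by (auto simp: apath_append_iff apath_simps)
    then show thesis
      by (rule path)
  next
    case True
    then obtain q r where qr: "p = q @ r" "awalk u q ?v" "awalk ?v r (tail G e)"
      using awalk_decomp[OF p(1)] by blast
    have "distinct (awalk_verts u q @ tl (awalk_verts ?v r))"
      using awalk_verts_append[of u q r] p qr by simp
    moreover have "awalk ?v (r @ [e]) ?v"
      using qr(3) e by (rule awalk_appendI)
    moreover have "awalk_verts ?v (r @ [e]) = awalk_verts ?v r @ [?v]"
      using awalk_verts_append[of ?v r "[e]" ?v] calculation(2) qr(3) by simp
    moreover have "?v \<in> set (awalk_verts u q)"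
      using qr(2) by (rule last_in_awalk_verts)
    ultimately have "apath u q ?v" "distinct (tl (awalk_verts ?v (r @ [e])))"
      using qr(2) by (auto simp: apath_def)
    then show thesis
      using qr(1) \<open>awalk ?v (r @ [e]) ?v\<close> by (intro cycle[of q r]) (auto simp: cycle_def)
  qed
qed

end

context fin_digraph
begin

lemma length_cycle_le:
  assumes "cycle c"
  shows "length c \<le> card (verts G)"
proof -
  obtain u where u: "awalk u c u" "distinct (tl (awalk_verts u c))"
    using assms by (auto simp: cycle_def)
  have "length c = card (set (tl (awalk_verts u c)))"
    using distinct_card[OF u(2)] by (simp add: length_awalk_verts)
  also have "\<dots> \<le> card (verts G)"
  proof (rule card_mono)
    show "set (tl (awalk_verts u c)) \<subseteq> verts G"
      using u(1) list.set_sel(2)[of "awalk_verts u c"] by (auto elim!: awalkE')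
  qed simp
  finally show ?thesis .
qed

lemma finite_cycles: "finite {c. cycle c}"
proof (rule finite_subset)
  show "{c. cycle c} \<subseteq> {c. set c \<subseteq> arcs G \<and> length c \<le> card (verts G)}"
    using length_cycle_le by (auto simp: cycle_def)
qed (simp add: finite_lists_length_le)

lemma awalk_reduces_to_apath:
  assumes "awalk u p v"
  shows "\<exists>s. apath u s v \<and> set (awalk_verts u s) \<subseteq> set (awalk_verts u p) \<and>
    cycle_reduction f (set (awalk_verts u p)) p s"
  using assms
proof (induction p arbitrary: v rule: rev_induct)
  case Nil
  then have "apath u [] v"
    by (auto simp: awalk_Nil_iff apath_Nil_iff)
  then show ?case
    using cycle_reduction_refl by blast
next
  case (snoc e p)
  let ?V = "set (awalk_verts u p)" and ?V' = "set (awalk_verts u (p @ [e]))"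
  have e: "e \<in> arcs G" "v = head G e" and p: "awalk u p (tail G e)"
    using snoc.prems by (auto simp: awalk_simps)
  have V': "?V' = insert v ?V"
    using set_awalk_verts_snoc[OF p e(1)] by (simp add: e(2))
  obtain s where s: "apath u s (tail G e)" "set (awalk_verts u s) \<subseteq> ?V" "cycle_reduction f ?V p s"
    using snoc.IH[OF p] by blast
  have se: "cycle_reduction f ?V' (p @ [e]) (s @ [e])"
    using cycle_reduction_mono[OF _ s(3)] V'
    by (intro cycle_reduction_append cycle_reduction_refl) auto
  from s(1) e(1) show ?case
  proof (cases rule: apath_snoc_cases)
    case path
    then show ?thesis
      using s(2) se V' set_awalk_verts_snoc[OF awalkI_apath[OF s(1)] e(1)] by (auto simp: e(2))
  next
    case (cycle q r)
    have "set (awalk_verts u q) \<subseteq> ?V'"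
      using s(1,2) cycle(1) V' by (auto simp: apath_def awalk_verts_append)
    moreover have "r @ [e] \<in> cycles_meeting ?V'"
      using cycle(3) V' by (auto simp: cycles_meeting_def walk_supp_def e(2))
    moreover have "cycle_reduction f ?V' (p @ [e]) (q @ r @ [e])"
      using se by (simp add: cycle(1))
    ultimately have "set (awalk_verts u q) \<subseteq> ?V'" "cycle_reduction f ?V' (p @ [e]) q"
      using cycle_reduction_remove_cycle by blast+
    then show ?thesis
      using cycle(2) unfolding e(2) by (intro exI[of _ q] conjI)
  qed
qed

definition short_cover ::
    "('b \<Rightarrow> 'z::comm_monoid_add) \<Rightarrow> 'a \<Rightarrow> 'a \<Rightarrow> 'a set \<Rightarrow> 'b list \<Rightarrow> 'b list \<Rightarrow> bool" where
  "short_cover f u v X p r \<longleftrightarrow> awalk u r v \<and> set (awalk_verts u r) = X \<and>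
     length r < card (verts G) * card X \<and> cycle_reduction f X p r"

lemma short_cover_single_vertex:
  assumes "awalk u q v" "set (awalk_verts u q) \<subseteq> {u}"
  shows "\<exists>r. short_cover f u v {u} q r"
proof -
  obtain s where s: "apath u s v" "set (awalk_verts u s) \<subseteq> set (awalk_verts u q)"
      "cycle_reduction f (set (awalk_verts u q)) q s"
    using awalk_reduces_to_apath[OF assms(1), of f] by blast
  then have "set (awalk_verts u s) = {u}" "set (awalk_verts u q) = {u}"
    using hd_in_awalk_verts(2)[OF s(1)] assms(2) by auto
  then show ?thesis
    using s length_apath_less[OF s(1)] by (auto simp: short_cover_def apath_def)
qed

lemma short_cover_new_vertex:
  assumes r: "short_cover f u (tail G e) X p r" and e: "e \<in> arcs G" "head G e \<notin> X"
    and q: "awalk (head G e) q v" "set (awalk_verts (head G e) q) \<subseteq> insert (head G e) X"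
  shows "\<exists>r'. short_cover f u v (insert (head G e) X) (p @ e # q) r'"
proof -
  let ?w = "head G e" and ?X = "insert (head G e) X"
  obtain s where s: "apath ?w s v" "set (awalk_verts ?w s) \<subseteq> set (awalk_verts ?w q)"
      "cycle_reduction f (set (awalk_verts ?w q)) q s"
    using awalk_reduces_to_apath[OF q(1), of f] by blast
  have X: "finite X" "tail G e \<in> X" and u: "awalk u r (tail G e)"
    using r last_in_awalk_verts[of u r "tail G e"] by (auto simp: short_cover_def)
  have es: "awalk (tail G e) (e # s) v"
    using e(1) s(1) by (simp add: apath_def awalk_Cons_iff)
  have "set (awalk_verts u (r @ e # s)) = ?X"
    using set_awalk_verts_append[OF u es] hd_in_awalk_verts(2)[OF s(1)] s(2) q(2) r X(2)
    by (auto simp: short_cover_def)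
  moreover have "length (r @ e # s) < card (verts G) * card ?X"
    using r length_apath_less[OF s(1)] e(2) X(1) by (simp add: short_cover_def)
  moreover have "cycle_reduction f ?X (p @ [e] @ q) (r @ [e] @ s)"
    using r cycle_reduction_mono[of X ?X] cycle_reduction_mono[OF q(2) s(3)]
    by (intro cycle_reduction_append cycle_reduction_refl) (auto simp: short_cover_def)
  ultimately have "short_cover f u v ?X (p @ e # q) (r @ e # s)"
    using awalk_appendI[OF u es] by (simp add: short_cover_def)
  then show ?thesis by blast
qed

text \<open>
  The continuation \<open>q\<close> of \<open>p\<close>, which visits no new vertices, is reduced to a path. Arcs of \<open>p\<close> to
  old vertices are moved into \<open>q\<close>, so only those to new vertices remain.
\<close>

lemma awalk_has_short_cover:
  assumes "awalk u p w" "awalk w q v" "set (awalk_verts w q) \<subseteq> set (awalk_verts u p)"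
  shows "\<exists>r. short_cover f u v (set (awalk_verts u p)) (p @ q) r"
  using assms
proof (induction p arbitrary: q w v rule: rev_induct)
  case Nil
  then have "u = w"
    by (simp add: awalk_Nil_iff)
  then show ?case
    using Nil.prems short_cover_single_vertex[of u q v] by simp
next
  case (snoc e p)
  let ?V = "set (awalk_verts u p)"
  have e: "e \<in> arcs G" "w = head G e" and p: "awalk u p (tail G e)"
    using snoc.prems(1) by (auto simp: awalk_simps)
  have V: "set (awalk_verts u (p @ [e])) = insert w ?V" and tail: "tail G e \<in> ?V"
    using set_awalk_verts_snoc[OF p e(1)] last_in_awalk_verts[OF p] by (simp_all add: e(2))
  have "\<exists>r. short_cover f u v (insert w ?V) (p @ e # q) r"
  proof (cases "w \<in> ?V")
    case True
    have "awalk (tail G e) (e # q) v" "set (awalk_verts (tail G e) (e # q)) \<subseteq> ?V"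
      using e snoc.prems(2,3) True tail by (auto simp: V awalk_Cons_iff)
    then show ?thesis
      using snoc.IH[OF p] True by (simp add: insert_absorb)
  next
    case False
    have "awalk (tail G e) [] (tail G e)" "set (awalk_verts (tail G e) []) \<subseteq> ?V"
      using p tail by (auto simp: awalk_Nil_iff)
    then obtain r where "short_cover f u (tail G e) ?V p r"
      using snoc.IH[OF p, of "[]" "tail G e"] by auto
    then show ?thesis
      using short_cover_new_vertex[of f u e ?V p r q v] e snoc.prems(2,3) V False by simp
  qed
  then show ?case
    by (simp add: V)
qed

theorem walk_sums_eq:
  "{walk_sum f p | p. awalk u p v} =
    (\<Union>p\<in>{p. awalk u p v \<and> length p < card (verts G) * card (verts G)}.
      {walk_sum f p} + nat_span (walk_sum f ` cycles_meeting (set (awalk_verts u p))))" (is "?L = ?R")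
proof
  show "?L \<subseteq> ?R"
  proof clarify
    fix p assume p: "awalk u p v"
    then have "awalk v [] v" "set (awalk_verts v []) \<subseteq> set (awalk_verts u p)"
      using last_in_awalk_verts[OF p] by (auto simp: awalk_Nil_iff)
    from awalk_has_short_cover[OF p this, of f] obtain r where
      r: "awalk u r v" "set (awalk_verts u r) = set (awalk_verts u p)"
        "length r < card (verts G) * card (set (awalk_verts u p))"
        "cycle_reduction f (set (awalk_verts u p)) p r"
      by (auto simp: short_cover_def)
    have "card (set (awalk_verts u p)) \<le> card (verts G)"
      using p by (intro card_mono) (auto elim!: awalkE')
    then have "length r < card (verts G) * card (verts G)"
      using r(3) by (meson less_le_trans mult_le_mono2)
    then show "walk_sum f p \<in> ?R"
      using r by (intro UN_I[of r]) (auto simp: cycle_reduction_def intro: set_plus_intro)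
  qed
  show "?R \<subseteq> ?L"
  proof (clarsimp elim!: set_plus_elim)
    fix p a assume "awalk u p v" "a \<in> nat_span (walk_sum f ` cycles_meeting (set (awalk_verts u p)))"
    then obtain p' where "awalk u p' v" "walk_sum f p' = walk_sum f p + a"
      using awalk_insert_cycles by blast
    then show "\<exists>p'. walk_sum f p + a = walk_sum f p' \<and> awalk u p' v"
      by metis
  qed
qed

end

section \<open>Periodic graphs\<close>

context periodic_graph
begin

sublocale G: wf_digraph "digraph_of \<Gamma>" by (rule wf)

sublocale Q: fin_digraph "quotient_graph \<Gamma>"
proof -
  interpret wf_digraph "quotient_graph \<Gamma>" by (rule wf_quotient_graph)
  show "fin_digraph (quotient_graph \<Gamma>)"
    by unfold_locales (simp_all add: quotient_graph_sel finite_vorbits finite_eorbits)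
qed

lemma vorbit_vact:
  assumes "a \<in> lattice \<Gamma>" "x \<in> verts (digraph_of \<Gamma>)"
  shows "vorbit \<Gamma> (vact \<Gamma> a x) = vorbit \<Gamma> x"
proof
  show "vorbit \<Gamma> (vact \<Gamma> a x) \<subseteq> vorbit \<Gamma> x"
    using assms by (auto simp: vorbit_def lattice_add simp flip: vact_add)
  show "vorbit \<Gamma> x \<subseteq> vorbit \<Gamma> (vact \<Gamma> a x)"
  proof (clarsimp simp: vorbit_def)
    fix b assume "b \<in> lattice \<Gamma>"
    then show "vact \<Gamma> b x \<in> (\<lambda>c. vact \<Gamma> c (vact \<Gamma> a x)) ` lattice \<Gamma>"
      using assms by (intro image_eqI[of _ _ "b - a"]) (simp_all add: lattice_diff flip: vact_add)
  qed
qed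

lemma vorbit_eqI:
  assumes "x \<in> verts (digraph_of \<Gamma>)" "y \<in> vorbit \<Gamma> x"
  shows "vorbit \<Gamma> y = vorbit \<Gamma> x" "y \<in> verts (digraph_of \<Gamma>)"
  using assms by (auto simp: vorbit_def[of _ x] vorbit_vact vact_closed)

text \<open>
  Choosing orbit representatives identifies the vertices with pairs of an orbit and a lattice element,
  and every arc of the quotient then carries a lattice element, additive along walks.
\<close>

definition position :: "'v \<Rightarrow> 'l" where
  "position x = (SOME a. a \<in> lattice \<Gamma> \<and> x = vact \<Gamma> a (SOME y. y \<in> vorbit \<Gamma> x))"

lemma orbit_representative:
  assumes "x \<in> verts (digraph_of \<Gamma>)"
  defines "r \<equiv> SOME y. y \<in> vorbit \<Gamma> x"
  shows "r \<in> verts (digraph_of \<Gamma>)" "position x \<in> lattice \<Gamma>" "x = vact \<Gamma> (position x) r"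
proof -
  have r: "r \<in> vorbit \<Gamma> x"
    unfolding r_def using vorbit_self[OF assms(1)] by (rule someI)
  then have "x \<in> vorbit \<Gamma> r"
    using vorbit_eqI(1)[OF assms(1) r] vorbit_self[OF assms(1)] by simp
  then have "\<exists>a. a \<in> lattice \<Gamma> \<and> x = vact \<Gamma> a r"
    by (auto simp: vorbit_def)
  then have "position x \<in> lattice \<Gamma> \<and> x = vact \<Gamma> (position x) r"
    unfolding position_def r_def by (rule someI_ex)
  then show "r \<in> verts (digraph_of \<Gamma>)" "position x \<in> lattice \<Gamma>" "x = vact \<Gamma> (position x) r"
    using vorbit_eqI(2)[OF assms(1) r] by auto
qed

lemma position_vact:
  assumes "a \<in> lattice \<Gamma>" "x \<in> verts (digraph_of \<Gamma>)"
  shows "position (vact \<Gamma> a x) = a + position x"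
proof -
  define r where "r = (SOME y. y \<in> vorbit \<Gamma> x)"
  have r: "r \<in> verts (digraph_of \<Gamma>)" "position x \<in> lattice \<Gamma>" "x = vact \<Gamma> (position x) r"
    using orbit_representative[OF assms(2)] by (simp_all add: r_def)
  have r': "position (vact \<Gamma> a x) \<in> lattice \<Gamma>" "vact \<Gamma> a x = vact \<Gamma> (position (vact \<Gamma> a x)) r"
    using orbit_representative[OF vact_closed[OF assms]] by (simp_all add: vorbit_vact assms r_def)
  have "vact \<Gamma> (position (vact \<Gamma> a x)) r = vact \<Gamma> (a + position x) r"
    using r r' assms(1) by (simp add: vact_add)
  then show ?thesis
    using r r' assms(1) by (intro vact_inj[of _ _ r] lattice_add) auto
qed

lemma position_eqD:
  assumes "x \<in> verts (digraph_of \<Gamma>)" "y \<in> verts (digraph_of \<Gamma>)"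
    and "vorbit \<Gamma> x = vorbit \<Gamma> y" "position x = position y"
  shows "x = y"
  using orbit_representative(3)[OF assms(1)] orbit_representative(3)[OF assms(2)] assms(3,4) by simp

definition arc_displacement :: "'e set \<Rightarrow> 'l" where
  "arc_displacement C =
     the_elem ((\<lambda>e. position (head (digraph_of \<Gamma>) e) - position (tail (digraph_of \<Gamma>) e)) ` C)"

lemma arc_displacement_eorbit:
  assumes "e \<in> arcs (digraph_of \<Gamma>)"
  shows "arc_displacement (eorbit \<Gamma> e)
    = position (head (digraph_of \<Gamma>) e) - position (tail (digraph_of \<Gamma>) e)"
proof -
  have "(\<lambda>e. position (head (digraph_of \<Gamma>) e) - position (tail (digraph_of \<Gamma>) e)) ` eorbit \<Gamma> e
      = {position (head (digraph_of \<Gamma>) e) - position (tail (digraph_of \<Gamma>) e)}"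
    using assms lattice_zero by (auto simp: eorbit_def image_image head_eact tail_eact position_vact)
  then show ?thesis
    by (simp add: arc_displacement_def)
qed

definition arc_label :: "'e set \<Rightarrow> 'l \<times> nat" where
  "arc_label C = (arc_displacement C, quotient_weight \<Gamma> C)"

lemma snd_walk_label: "snd (walk_sum arc_label q) = walk_weight (quotient_weight \<Gamma>) q"
  by (induction q) (simp_all add: arc_label_def walk_weight_def)

lemma walk_label_projection:
  "G.awalk x p y \<Longrightarrow>
    walk_sum arc_label (map (eorbit \<Gamma>) p) = (position y - position x, walk_weight (weight \<Gamma>) p)"
proof (induction p arbitrary: x)
  case (Cons e p)
  then have "e \<in> arcs (digraph_of \<Gamma>)" "x = tail (digraph_of \<Gamma>) e" "G.awalk (head (digraph_of \<Gamma>) e) p y"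
    by (auto simp: G.awalk_Cons_iff)
  then show ?case
    using Cons.IH by (simp add: arc_label_def arc_displacement_eorbit quotient_weight_eorbit walk_weight_def)
qed (simp add: G.awalk_Nil_iff walk_weight_def zero_prod_def)

lemma walk_label_cycle:
  assumes "is_quotient_cycle \<Gamma> q"
  shows "walk_sum arc_label q = (cycle_displacement \<Gamma> q, cycle_weight \<Gamma> q)"
proof -
  obtain x p where p: "G.awalk x p (vact \<Gamma> (cycle_displacement \<Gamma> q) x)" "map (eorbit \<Gamma>) p = q"
      "cycle_displacement \<Gamma> q \<in> lattice \<Gamma>"
    using assms by (rule quotient_cycle_lift)
  then have "x \<in> verts (digraph_of \<Gamma>)" by auto
  then have "fst (walk_sum arc_label q) = cycle_displacement \<Gamma> q"
    using walk_label_projection[OF p(1)] p(2,3) by (simp add: position_vact)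
  then show ?thesis
    by (simp add: prod_eq_iff snd_walk_label)
qed

lemma projection_awalk:
  "G.awalk x p y \<Longrightarrow> Q.awalk (vorbit \<Gamma> x) (map (eorbit \<Gamma>) p) (vorbit \<Gamma> y)"
  by (induction p arbitrary: x)
     (auto simp: G.awalk_simps Q.awalk_simps quotient_graph_sel tail_eorbit head_eorbit)

lemma quotient_weight_pos: "C \<in> arcs (quotient_graph \<Gamma>) \<Longrightarrow> quotient_weight \<Gamma> C > 0"
  using weight_pos by (auto simp: quotient_graph_sel quotient_weight_eorbit)

lemma length_le_quotient_walk_weight:
  "set q \<subseteq> arcs (quotient_graph \<Gamma>) \<Longrightarrow> length q \<le> walk_weight (quotient_weight \<Gamma>) q"
  by (induction q) (auto simp: walk_weight_def Suc_le_eq intro: add_less_le_mono dest: quotient_weight_pos)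

lemma graph_dist_le_iff:
  "graph_dist \<Gamma> x y \<le> enat d \<longleftrightarrow> (\<exists>p. G.awalk x p y \<and> walk_weight (weight \<Gamma>) p \<le> d)"
proof -
  have "graph_dist \<Gamma> x y \<le> enat d \<longleftrightarrow> graph_dist \<Gamma> x y < enat (Suc d)"
    by (cases "graph_dist \<Gamma> x y") auto
  also have "\<dots> \<longleftrightarrow> (\<exists>p. G.awalk x p y \<and> walk_weight (weight \<Gamma>) p < Suc d)"
    unfolding graph_dist_def by (simp add: INF_less_iff)
  finally show ?thesis by (simp add: less_Suc_eq_le)
qed

definition distance_ball :: "'v \<Rightarrow> nat \<Rightarrow> 'v set" where
  "distance_ball x d = {y \<in> verts (digraph_of \<Gamma>). graph_dist \<Gamma> x y \<le> enat d}"

lemma in_distance_ball_iff: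
  "y \<in> distance_ball x d \<longleftrightarrow> (\<exists>p. G.awalk x p y \<and> walk_weight (weight \<Gamma>) p \<le> d)"
  by (auto simp: distance_ball_def graph_dist_le_iff)

definition ball_labels :: "'v \<Rightarrow> 'v set \<Rightarrow> ('l \<times> nat) set" where
  "ball_labels x Y = {walk_sum arc_label q | q. Q.awalk (vorbit \<Gamma> x) q Y} + nat_span {(0, 1)}"

lemma ball_labels_iff:
  "(a, d) \<in> ball_labels x Y \<longleftrightarrow>
    (\<exists>q. Q.awalk (vorbit \<Gamma> x) q Y \<and> fst (walk_sum arc_label q) = a \<and> walk_weight (quotient_weight \<Gamma>) q \<le> d)"
proof -
  have ball_labels_eq: "ball_labels x Y = {walk_sum arc_label q | q. Q.awalk (vorbit \<Gamma> x) q Y} + range (\<lambda>n. (0, n))"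
    by (simp add: ball_labels_def nat_span_singleton nat_multiple_Pair nat_multiple_scaleR nat_multiple_nat)
  show ?thesis
  proof
    assume "(a, d) \<in> ball_labels x Y"
    then obtain q n where "Q.awalk (vorbit \<Gamma> x) q Y" "(a, d) = walk_sum arc_label q + (0, n)"
      unfolding ball_labels_eq by (elim set_plus_elim) auto
    then show "\<exists>q. Q.awalk (vorbit \<Gamma> x) q Y \<and> fst (walk_sum arc_label q) = a \<and>
        walk_weight (quotient_weight \<Gamma>) q \<le> d"
      by (auto simp: prod_eq_iff snd_walk_label)
  next
    assume "\<exists>q. Q.awalk (vorbit \<Gamma> x) q Y \<and> fst (walk_sum arc_label q) = a \<and>
        walk_weight (quotient_weight \<Gamma>) q \<le> d"
    then obtain q n where q: "Q.awalk (vorbit \<Gamma> x) q Y"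
        and "(a, d) = walk_sum arc_label q + (0, n)"
      by (auto simp: prod_eq_iff snd_walk_label le_iff_add)
    then show "(a, d) \<in> ball_labels x Y"
      unfolding ball_labels_eq by (auto intro!: set_plus_intro)
  qed
qed

lemma bij_betw_ball_labels:
  assumes "x \<in> verts (digraph_of \<Gamma>)" "Y \<in> verts (quotient_graph \<Gamma>)"
  shows "bij_betw (\<lambda>y. (position y - position x, d))
    {y \<in> distance_ball x d. vorbit \<Gamma> y = Y} {z \<in> ball_labels x Y. snd z = d}" (is "bij_betw ?f ?A ?B")
proof (rule bij_betw_imageI)
  show "inj_on ?f ?A"
    by (auto simp: inj_on_def distance_ball_def intro: position_eqD)
  show "?f ` ?A = ?B"
  proof (intro equalityI subsetI)
    fix z assume "z \<in> ?f ` ?A"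
    then obtain y p where y: "z = ?f y" "vorbit \<Gamma> y = Y"
        and p: "G.awalk x p y" "walk_weight (weight \<Gamma>) p \<le> d"
      by (auto simp: in_distance_ball_iff)
    show "z \<in> ?B"
      using projection_awalk[OF p(1)] walk_label_projection[OF p(1)] p(2) y
      by (auto simp: ball_labels_iff simp flip: snd_walk_label intro!: exI[of _ "map (eorbit \<Gamma>) p"])
  next
    fix z assume "z \<in> ?B"
    then obtain a where z: "z = (a, d)" "(a, d) \<in> ball_labels x Y"
      by (cases z) auto
    then obtain q where q: "Q.awalk (vorbit \<Gamma> x) q Y" "fst (walk_sum arc_label q) = a"
        "walk_weight (quotient_weight \<Gamma>) q \<le> d"
      by (auto simp: ball_labels_iff)
    obtain p y where p: "G.awalk x p y" "map (eorbit \<Gamma>) p = q" "y \<in> Y"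
      using lift_walk[OF q(1) vorbit_self[OF assms(1)]] by blast
    have "walk_sum arc_label q = (position y - position x, walk_weight (weight \<Gamma>) p)"
      using walk_label_projection[OF p(1)] p(2) by simp
    then have "y \<in> distance_ball x d" "z = ?f y"
      using p(1) q(2,3) z(1) by (auto simp: in_distance_ball_iff simp flip: snd_walk_label)
    moreover have "vorbit \<Gamma> y = Y"
      using assms(2) p(3) vorbit_eqI(1) by (auto simp: quotient_graph_sel)
    ultimately show "z \<in> ?f ` ?A"
      by blast
  qed
qed

lemma finite_ball_labels: "finite {z \<in> ball_labels x Y. snd z = d}"
proof (rule finite_subset)
  let ?W = "{q. set q \<subseteq> arcs (quotient_graph \<Gamma>) \<and> length q \<le> d}"
  show "{z \<in> ball_labels x Y. snd z = d} \<subseteq> (\<lambda>q. (fst (walk_sum arc_label q), d)) ` ?W"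
  proof
    fix z assume "z \<in> {z \<in> ball_labels x Y. snd z = d}"
    then obtain a where a: "z = (a, d)" "(a, d) \<in> ball_labels x Y"
      by (cases z) auto
    then obtain q where q: "Q.awalk (vorbit \<Gamma> x) q Y" "fst (walk_sum arc_label q) = a"
        "walk_weight (quotient_weight \<Gamma>) q \<le> d"
      by (auto simp: ball_labels_iff)
    then have "q \<in> ?W"
      using length_le_quotient_walk_weight[of q] by auto
    then show "z \<in> (\<lambda>q. (fst (walk_sum arc_label q), d)) ` ?W"
      using q(2) a(1) by auto
  qed
  show "finite ((\<lambda>q. (fst (walk_sum arc_label q), d)) ` ?W)"
    by (intro finite_imageI finite_lists_length_le) simp
qed

lemma
  assumes "x \<in> verts (digraph_of \<Gamma>)"
  shows finite_distance_ball: "finite (distance_ball x d)"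
    and card_distance_ball: "card (distance_ball x d) =
      (\<Sum>Y\<in>verts (quotient_graph \<Gamma>). card {z \<in> ball_labels x Y. snd z = d})"
proof -
  let ?A = "\<lambda>Y. {y \<in> distance_ball x d. vorbit \<Gamma> y = Y}"
  have A: "finite (?A Y)" "card (?A Y) = card {z \<in> ball_labels x Y. snd z = d}"
    if "Y \<in> verts (quotient_graph \<Gamma>)" for Y
    using bij_betw_ball_labels[OF assms that, of d] finite_ball_labels
    by (auto simp: bij_betw_finite bij_betw_same_card)
  have ball: "distance_ball x d = (\<Union>Y\<in>verts (quotient_graph \<Gamma>). ?A Y)"
    by (auto simp: distance_ball_def quotient_graph_sel)
  show "finite (distance_ball x d)"
    by (subst ball) (simp add: A(1))
  have "card (distance_ball x d) = (\<Sum>Y\<in>verts (quotient_graph \<Gamma>). card (?A Y))"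
    by (subst ball, intro card_UN_disjoint) (auto simp: A(1))
  then show "card (distance_ball x d) =
      (\<Sum>Y\<in>verts (quotient_graph \<Gamma>). card {z \<in> ball_labels x Y. snd z = d})"
    using A(2) by simp
qed

lemma growth_series_eq:
  assumes "x \<in> verts (digraph_of \<Gamma>)"
  shows "growth_series \<Gamma> x
    = (1 - fps_X) * (\<Sum>Y\<in>verts (quotient_graph \<Gamma>). hilbert_series snd (ball_labels x Y))"
proof (rule fps_ext)
  fix d
  let ?H = "\<Sum>Y\<in>verts (quotient_graph \<Gamma>). hilbert_series snd (ball_labels x Y)"
  have H: "fps_nth ?H d = of_nat (card (distance_ball x d))" for d
    by (simp add: card_distance_ball[OF assms] fps_sum_nth)
  show "fps_nth (growth_series \<Gamma> x) d = fps_nth ((1 - fps_X) * ?H) d"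
  proof (cases d)
    case 0
    then have "growth_seq \<Gamma> x d = card (distance_ball x d)"
      by (simp add: growth_seq_def distance_ball_def flip: zero_enat_def)
    then show ?thesis
      using 0 by (simp add: growth_series_def left_diff_distrib H)
  next
    case (Suc k)
    have "graph_dist \<Gamma> x y = enat (Suc k) \<longleftrightarrow>
        graph_dist \<Gamma> x y \<le> enat (Suc k) \<and> \<not> graph_dist \<Gamma> x y \<le> enat k" for y
      by (cases "graph_dist \<Gamma> x y") auto
    then have "growth_seq \<Gamma> x d = card (distance_ball x (Suc k) - distance_ball x k)"
      unfolding growth_seq_def distance_ball_def Suc by (intro arg_cong[where f = card]) auto
    moreover have "distance_ball x k \<subseteq> distance_ball x (Suc k)"
      by (auto simp: distance_ball_def intro: order_trans)
    moreover have "finite (distance_ball x (Suc k))"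
      using assms by (rule finite_distance_ball)
    ultimately have "growth_seq \<Gamma> x d + card (distance_ball x k) = card (distance_ball x (Suc k))"
      by (simp add: card_Diff_subset card_mono finite_subset)
    then show ?thesis
      using arg_cong[of _ _ "of_nat :: nat \<Rightarrow> complex"]
      by (simp add: growth_series_def left_diff_distrib H Suc) (metis add_diff_cancel_right' of_nat_add)
  qed
qed

theorem finitely_generated_ball_labels:
  assumes gens: "(0, 1) \<in> gens"
      "gens \<subseteq> insert (0, 1) (walk_sum arc_label ` Q.cycles_meeting {vorbit \<Gamma> x})"
    and multiple: "\<And>c. Q.cycle c \<Longrightarrow> \<exists>k>0. nat_multiple k (walk_sum arc_label c) \<in> nat_span gens"
  shows "finitely_generated gens (ball_labels x Y)"
proof -
  let ?X = "vorbit \<Gamma> x"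
  let ?n = "card (verts (quotient_graph \<Gamma>))"
  let ?cycles = "\<lambda>p. walk_sum arc_label ` Q.cycles_meeting (set (Q.awalk_verts ?X p))"
  have "finitely_generated gens ({walk_sum arc_label p} + nat_span (?cycles p) + nat_span {(0, 1)})"
    if p: "Q.awalk ?X p Y" for p
  proof -
    have "?X \<in> set (Q.awalk_verts ?X p)"
      using p by (rule Q.hd_in_awalk_verts)
    then have "walk_sum arc_label ` Q.cycles_meeting {?X} \<subseteq> ?cycles p"
      by (intro image_mono Q.cycles_meeting_mono) simp
    then have "?cycles p \<union> {(0, 1)} = ?cycles p \<union> gens"
      using gens by blast
    moreover have "finite (?cycles p)"
      using Q.finite_cycles by (auto simp: Q.cycles_meeting_def)
    moreover have "\<exists>k>0. nat_multiple k h \<in> nat_span gens" if "h \<in> ?cycles p" for h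
      using that multiple by (auto simp: Q.cycles_meeting_def)
    ultimately have "finitely_generated gens (nat_span (?cycles p) + nat_span {(0, 1)})"
      by (metis finitely_generated_nat_span_of_multiples nat_span_Un)
    then show ?thesis
      by (simp add: add.assoc finitely_generated_finite_plus)
  qed
  moreover have "finite {p. Q.awalk ?X p Y \<and> length p < ?n * ?n}"
    by (rule finite_subset[OF _ finite_lists_length_le[of "arcs (quotient_graph \<Gamma>)" "?n * ?n"]]) auto
  ultimately show ?thesis
    unfolding ball_labels_def Q.walk_sums_eq set_plus_UN_distrib
    by (intro finitely_generated_UN) auto
qed

lemma cycle_weight_pos: "is_quotient_cycle \<Gamma> c \<Longrightarrow> cycle_weight \<Gamma> c > 0"
  using length_le_quotient_walk_weight[of c]
  by (cases c) (auto simp: is_quotient_cycle_def Q.cycle_def)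

lemma cycle_displacement_in_lattice: "is_quotient_cycle \<Gamma> c \<Longrightarrow> cycle_displacement \<Gamma> c \<in> lattice \<Gamma>"
  by (erule quotient_cycle_lift)

lemma cycle_displacement_eq_direction:
  "is_quotient_cycle \<Gamma> c \<Longrightarrow> cycle_displacement \<Gamma> c = real (cycle_weight \<Gamma> c) *\<^sub>R cycle_direction \<Gamma> c"
  using cycle_weight_pos by (fastforce simp: cycle_direction_def)

lemma finite_cycle_directions: "finite {cycle_direction \<Gamma> c | c. is_quotient_cycle \<Gamma> c}"
  using Q.finite_cycles by (simp add: is_quotient_cycle_def)

definition nonzero_vertices :: "'l set" where
  "nonzero_vertices = polytope_vertices (growth_polytope \<Gamma>) - {0}"

lemma zero_notin_nonzero_vertices: "0 \<notin> nonzero_vertices"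
  by (simp add: nonzero_vertices_def)

lemma finite_nonzero_vertices: "finite nonzero_vertices"
proof (rule finite_subset)
  show "nonzero_vertices \<subseteq> {cycle_direction \<Gamma> c | c. is_quotient_cycle \<Gamma> c}"
    unfolding nonzero_vertices_def polytope_vertices_def growth_polytope_def
    by (blast dest: extreme_point_of_convex_hull)
qed (simp add: finite_cycle_directions)

lemma growth_polytope_subset_hull: "growth_polytope \<Gamma> \<subseteq> convex hull (insert 0 nonzero_vertices)"
proof -
  have "compact (growth_polytope \<Gamma>)"
    unfolding growth_polytope_def by (intro finite_imp_compact_convex_hull) (simp add: finite_cycle_directions)
  then have "growth_polytope \<Gamma> = convex hull (polytope_vertices (growth_polytope \<Gamma>))"
    unfolding polytope_vertices_def by (intro Krein_Milman_Minkowski) (simp_all add: growth_polytope_def)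
  moreover have "polytope_vertices (growth_polytope \<Gamma>) \<subseteq> insert 0 nonzero_vertices"
    by (auto simp: nonzero_vertices_def)
  ultimately show ?thesis
    by (metis hull_mono)
qed

lemma unweighted_cycle_weight:
  assumes "unweighted \<Gamma>" "is_quotient_cycle \<Gamma> c"
  shows "cycle_weight \<Gamma> c = length c"
proof -
  have "set c \<subseteq> arcs (quotient_graph \<Gamma>)"
    using assms(2) by (auto simp: is_quotient_cycle_def Q.cycle_def)
  then show ?thesis
    using assms(1) by (induction c)
      (auto simp: walk_weight_def quotient_graph_sel quotient_weight_eorbit unweighted_def)
qed

end

locale initial_vertex_cycles = periodic_graph n \<Gamma>
  for n :: nat and \<Gamma> :: "('v, 'e, 'l::euclidean_space) periodic_graph_data" +
  fixes x\<^sub>0 :: 'v and q :: "'l \<Rightarrow> 'e set list"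
  assumes x\<^sub>0_in_verts: "x\<^sub>0 \<in> verts (digraph_of \<Gamma>)"
    and vertex_cycle: "v \<in> nonzero_vertices \<Longrightarrow>
      is_quotient_cycle \<Gamma> (q v) \<and> cycle_direction \<Gamma> (q v) = v \<and>
      vorbit \<Gamma> x\<^sub>0 \<in> walk_supp (quotient_graph \<Gamma>) (q v)"
begin

lemma vertex_cycle_weight_pos: "v \<in> nonzero_vertices \<Longrightarrow> cycle_weight \<Gamma> (q v) > 0"
  using vertex_cycle cycle_weight_pos by blast

text \<open>The label \<open>(0, 1)\<close>, which only raises the distance bound, stands for the vertex \<open>0\<close>.\<close>

definition vertex_label :: "'l \<Rightarrow> 'l \<times> nat" where
  "vertex_label v = (if v = 0 then (0, 1) else walk_sum arc_label (q v))"

lemma vertex_label_0 [simp]: "vertex_label 0 = (0, 1)"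
  by (simp add: vertex_label_def)

lemma vertex_label_nonzero:
  "v \<in> nonzero_vertices \<Longrightarrow> vertex_label v = walk_sum arc_label (q v)"
  using zero_notin_nonzero_vertices by (auto simp: vertex_label_def)

lemma vertex_label_in_lattice:
  "v \<in> insert 0 nonzero_vertices \<Longrightarrow> fst (vertex_label v) \<in> lattice \<Gamma>"
  using vertex_cycle[of v]
  by (auto simp: lattice_zero vertex_label_nonzero walk_label_cycle cycle_displacement_in_lattice)

lemma snd_vertex_label:
  "v \<in> nonzero_vertices \<Longrightarrow> snd (vertex_label v) = cycle_weight \<Gamma> (q v)"
  by (simp add: vertex_label_nonzero snd_walk_label)

lemma snd_vertex_label_pos: "v \<in> insert 0 nonzero_vertices \<Longrightarrow> snd (vertex_label v) > 0"
  by (auto simp: snd_vertex_label vertex_cycle_weight_pos)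

lemma fst_vertex_label:
  assumes "v \<in> insert 0 nonzero_vertices"
  shows "fst (vertex_label v) = real (snd (vertex_label v)) *\<^sub>R v"
  using assms vertex_cycle[of v] cycle_displacement_eq_direction[of "q v"]
  by (auto simp: vertex_label_nonzero walk_label_cycle)

lemma inj_on_vertex_label: "inj_on vertex_label (insert 0 nonzero_vertices)"
proof (rule inj_onI)
  fix v v'
  assume v: "v \<in> insert 0 nonzero_vertices" "v' \<in> insert 0 nonzero_vertices"
    and "vertex_label v = vertex_label v'"
  then have "real (snd (vertex_label v)) *\<^sub>R v = real (snd (vertex_label v)) *\<^sub>R v'"
    using fst_vertex_label[OF v(1)] fst_vertex_label[OF v(2)] by metis
  then show "v = v'"
    using snd_vertex_label_pos[OF v(1)] unfolding scaleR_cancel_left by simp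
qed

lemma cycle_label_multiple:
  assumes "is_quotient_cycle \<Gamma> c"
  shows "\<exists>k>0. nat_multiple k (walk_sum arc_label c) \<in> nat_span (vertex_label ` insert 0 nonzero_vertices)"
proof -
  let ?V = "insert 0 nonzero_vertices" and ?w = "real (cycle_weight \<Gamma> c)"
  let ?s = "\<lambda>v. real (snd (vertex_label v))"
  have "cycle_direction \<Gamma> c \<in> growth_polytope \<Gamma>"
    unfolding growth_polytope_def by (rule hull_inc) (use assms in auto)
  then have "cycle_direction \<Gamma> c \<in> convex hull ?V"
    using growth_polytope_subset_hull by blast
  then obtain u where u: "\<And>v. v \<in> ?V \<Longrightarrow> u v \<ge> 0" "sum u ?V = 1"
      "(\<Sum>v\<in>?V. u v *\<^sub>R v) = cycle_direction \<Gamma> c"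
    using finite_nonzero_vertices by (auto simp: convex_hull_finite)
  have "cycle_displacement \<Gamma> c = (\<Sum>v\<in>?V. (?w * u v / ?s v) *\<^sub>R fst (vertex_label v))"
  proof -
    have "cycle_displacement \<Gamma> c = (\<Sum>v\<in>?V. (?w * u v) *\<^sub>R v)"
      using cycle_displacement_eq_direction[OF assms] by (simp add: scaleR_sum_right flip: u(3))
    also have "\<dots> = (\<Sum>v\<in>?V. (?w * u v / ?s v) *\<^sub>R fst (vertex_label v))"
      using fst_vertex_label snd_vertex_label_pos by (intro sum.cong refl) fastforce
    finally show ?thesis .
  qed
  moreover have "?w = (\<Sum>v\<in>?V. ?w * u v / ?s v * ?s v)"
  proof -
    have "?w = (\<Sum>v\<in>?V. ?w * u v)"
      using u(2) by (simp flip: sum_distrib_left)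
    also have "\<dots> = (\<Sum>v\<in>?V. ?w * u v / ?s v * ?s v)"
      using snd_vertex_label_pos by (intro sum.cong refl) fastforce
    finally show ?thesis .
  qed
  ultimately show ?thesis
    unfolding walk_label_cycle[OF assms]
    using u(1) cycle_displacement_in_lattice[OF assms]
    by (intro lattice_cone_multiple_in_nat_span[OF lattice vertex_label_in_lattice]) auto
qed

lemma finitely_generated_ball_labels_vertex_labels:
  "finitely_generated (vertex_label ` insert 0 nonzero_vertices) (ball_labels x\<^sub>0 Y)"
proof (rule finitely_generated_ball_labels)
  have "vertex_label v \<in> walk_sum arc_label ` Q.cycles_meeting {vorbit \<Gamma> x\<^sub>0}" if "v \<in> nonzero_vertices" for v
    using vertex_cycle[OF that] that
    by (auto simp: vertex_label_nonzero Q.cycles_meeting_def is_quotient_cycle_def)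
  then show "vertex_label ` insert 0 nonzero_vertices
      \<subseteq> insert (0, 1) (walk_sum arc_label ` Q.cycles_meeting {vorbit \<Gamma> x\<^sub>0})"
    by auto
  show "(0, 1) \<in> vertex_label ` insert 0 nonzero_vertices"
    by simp
  show "\<exists>k>0. nat_multiple k (walk_sum arc_label c) \<in> nat_span (vertex_label ` insert 0 nonzero_vertices)"
    if "Q.cycle c" for c
    using that by (intro cycle_label_multiple) (simp add: is_quotient_cycle_def)
qed

theorem growth_series_rational:
  "growth_series \<Gamma> x\<^sub>0 * (\<Prod>v\<in>nonzero_vertices. 1 - fps_X ^ cycle_weight \<Gamma> (q v)) \<in> range fps_of_poly"
proof -
  interpret graded_monoid "snd :: 'l \<times> nat \<Rightarrow> nat"
    by unfold_locales simp
  let ?V = "insert 0 nonzero_vertices"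
  let ?D = "\<Prod>g\<in>vertex_label ` ?V. 1 - fps_X ^ snd g :: complex fps"
  have "finite ?V"
    using finite_nonzero_vertices by simp
  then have "hilbert_series snd (ball_labels x\<^sub>0 Y) * ?D \<in> range fps_of_poly" for Y
    using finitely_generated_ball_labels_vertex_labels snd_vertex_label_pos
    by (intro hilbert_series_finitely_generated) auto
  then have "(\<Sum>Y\<in>verts (quotient_graph \<Gamma>). hilbert_series snd (ball_labels x\<^sub>0 Y)) * ?D \<in> range fps_of_poly"
    unfolding sum_distrib_right by (rule range_fps_of_poly_sum)
  moreover have "?D = (1 - fps_X) * (\<Prod>v\<in>nonzero_vertices. 1 - fps_X ^ cycle_weight \<Gamma> (q v))"
  proof -
    have "?D = (\<Prod>v\<in>?V. 1 - fps_X ^ snd (vertex_label v))"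
      using prod.reindex[OF inj_on_vertex_label, of "\<lambda>g. 1 - fps_X ^ snd g"] by simp
    also have "\<dots> = (1 - fps_X) * (\<Prod>v\<in>nonzero_vertices. 1 - fps_X ^ snd (vertex_label v))"
      using finite_nonzero_vertices zero_notin_nonzero_vertices by simp
    finally show ?thesis
      by (simp add: snd_vertex_label)
  qed
  ultimately show ?thesis
    by (simp add: growth_series_eq[OF x\<^sub>0_in_verts] mult_ac)
qed

lemma has_quasi_period_growth_seq:
  assumes "N > 0" "\<And>v. v \<in> nonzero_vertices \<Longrightarrow> cycle_weight \<Gamma> (q v) dvd N"
  shows "has_quasi_period (\<lambda>d. of_nat (growth_seq \<Gamma> x\<^sub>0 d)) N"
proof -
  have "fps_nth (growth_series \<Gamma> x\<^sub>0) = (\<lambda>d. of_nat (growth_seq \<Gamma> x\<^sub>0 d))"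
    by (rule ext) (simp add: growth_series_def)
  then show ?thesis
    using has_quasi_period_prod_denominator[OF assms growth_series_rational] by simp
qed

lemma has_quasi_period_growth_seq_Lcm:
  "has_quasi_period (\<lambda>d. of_nat (growth_seq \<Gamma> x\<^sub>0 d))
    (Lcm ((\<lambda>v. cycle_weight \<Gamma> (q v)) ` nonzero_vertices))" (is "has_quasi_period _ (Lcm ?W)")
proof (rule has_quasi_period_growth_seq)
  have "finite ?W" "0 \<notin> ?W"
    using finite_nonzero_vertices vertex_cycle_weight_pos by (auto simp: image_iff)
  then show "Lcm ?W > 0"
    by (simp add: Lcm_0_iff neq0_conv[symmetric] del: neq0_conv)
qed (auto intro: dvd_Lcm)

lemma has_quasi_period_growth_seq_unweighted:
  assumes "unweighted \<Gamma>"
  shows "has_quasi_period (\<lambda>d. of_nat (growth_seq \<Gamma> x\<^sub>0 d)) (Lcm {1..card (verts (quotient_graph \<Gamma>))})"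
proof (rule has_quasi_period_growth_seq)
  show "Lcm {1..card (verts (quotient_graph \<Gamma>))} > 0"
    by (simp add: Lcm_0_iff neq0_conv[symmetric] del: neq0_conv)
next
  fix v assume v: "v \<in> nonzero_vertices"
  then have "cycle_weight \<Gamma> (q v) = length (q v)"
    using assms vertex_cycle unweighted_cycle_weight by blast
  then have "cycle_weight \<Gamma> (q v) \<le> card (verts (quotient_graph \<Gamma>))"
    using vertex_cycle[OF v] Q.length_cycle_le by (simp add: is_quotient_cycle_def)
  then show "cycle_weight \<Gamma> (q v) dvd Lcm {1..card (verts (quotient_graph \<Gamma>))}"
    using vertex_cycle_weight_pos[OF v] by (intro dvd_Lcm) simp
qed

end

theorem theorem5p1:
  fixes \<Gamma> :: "('v, 'e, 'l::euclidean_space) periodic_graph_data"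
    and n :: nat and x\<^sub>0 :: 'v and q :: "'l \<Rightarrow> 'e set list"
  assumes "periodic_graph n \<Gamma>"
    and "P_initial \<Gamma> x\<^sub>0"
    and "\<And>v. v \<in> polytope_vertices (growth_polytope \<Gamma>) - {0} \<Longrightarrow>
           is_quotient_cycle \<Gamma> (q v) \<and> cycle_direction \<Gamma> (q v) = v \<and>
           vorbit \<Gamma> x\<^sub>0 \<in> walk_supp (quotient_graph \<Gamma>) (q v)"
  shows "has_quasi_period (\<lambda>d. of_nat (growth_seq \<Gamma> x\<^sub>0 d))
           (Lcm ((\<lambda>v. cycle_weight \<Gamma> (q v)) ` (polytope_vertices (growth_polytope \<Gamma>) - {0})))
       \<and> (\<exists>Q :: complex poly. growth_series \<Gamma> x\<^sub>0 =
           fps_of_poly Q /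
           (\<Prod>v \<in> polytope_vertices (growth_polytope \<Gamma>) - {0}. 1 - fps_X ^ cycle_weight \<Gamma> (q v)))
       \<and> (unweighted \<Gamma> \<longrightarrow>
           has_quasi_period (\<lambda>d. of_nat (growth_seq \<Gamma> x\<^sub>0 d))
             (Lcm {1..card (verts (quotient_graph \<Gamma>))}))"
proof -
  interpret periodic_graph n \<Gamma> by fact
  interpret initial_vertex_cycles n \<Gamma> x\<^sub>0 q
    using assms(2,3) by unfold_locales (auto simp: P_initial_def nonzero_vertices_def)
  let ?D = "\<Prod>v\<in>nonzero_vertices. 1 - fps_X ^ cycle_weight \<Gamma> (q v) :: complex fps"
  obtain Q where "growth_series \<Gamma> x\<^sub>0 * ?D = fps_of_poly Q"
    using growth_series_rational by auto
  moreover have "?D \<noteq> 0"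
    using vertex_cycle_weight_pos by (rule prod_one_minus_fps_X_power_neq_0)
  ultimately have "growth_series \<Gamma> x\<^sub>0 = fps_of_poly Q / ?D"
    by (metis nonzero_mult_div_cancel_right)
  then show ?thesis
    using has_quasi_period_growth_seq_Lcm has_quasi_period_growth_seq_unweighted
    unfolding nonzero_vertices_def by blast
qed

end
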